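(* Let $\mathbb{K}$ be an algebraically closed field of characteristic $0$, let $q\in\mathbb{K}$ be nonzero and not a root of unity, and let $V$ be a vector space over $\mathbb{K}$ with finite positive dimension. Let $A,A^*$ be a tridiagonal pair on $V$ of diameter $d$ which satisfies the $q$-Serre relations $$A^3A^*-[3]A^2A^*A+[3]AA^*A^2-A^*A^3=0,$$ $$A^{*3}A-[3]A^{*2}AA^*+[3]A^*AA^{*2}-AA^{*3}=0,$$ where $[3]=(q^3-q^{-3})/(q-q^{-1})$. Let $a,a^*\in\mathbb{K}$ be such that $\theta_i=aq^{2i-d}$ $(0\le i\le d)$ is a standard ordering of the eigenvalues of $A$ and $\theta^*_i=a^*q^{d-2i}$ $(0\le i\le d)$ is a standard ordering of the eigenvalues of $A^*$. Let $U_0,U_1,\ldots,U_d$ denote the split decomposition for $A,A^*$ with respect to these orderings, and let $R$ and $L$ denote the corresponding raising and lowering maps. Let $v$ denote a nonzero vector in $U_0$. Then $V$ is spanned by the vectors of the form $$L^{i_1}R^{i_2}L^{i_3}R^{i_4}\cdots R^{i_n}v,$$ where $i_1,i_2,\ldots,i_n$ ranges over all sequences such that $n$ is a nonnegative even integer and $i_1,i_2,\ldots,i_n$ are integers satisfying $0\le i_1<i_2<\cdots<i_n\le d$.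
   Context: A linear transformation $V\to V$ is diagonalizable if $V$ is spanned by its eigenspaces. Tridiagonal pair: an ordered pair $A,A^*$ of linear transformations $V\to V$ (here $A^*$ is just a name; it is not the conjugate-transpose of $A$) such that (i) each of $A,A^*$ is diagonalizable; (ii) there is an ordering $V_0,V_1,\ldots,V_d$ of the eigenspaces of $A$ with $A^*V_i\subseteq V_{i-1}+V_i+V_{i+1}$ for $0\le i\le d$, where $V_{-1}=V_{d+1}=0$; (iii) there is an ordering $V^*_0,V^*_1,\ldots,V^*_\delta$ of the eigenspaces of $A^*$ with $AV^*_i\subseteq V^*_{i-1}+V^*_i+V^*_{i+1}$ for $0\le i\le\delta$, where $V^*_{-1}=V^*_{\delta+1}=0$; (iv) there is no subspace $W$ of $V$ with $AW\subseteq W$, $A^*W\subseteq W$, $W\ne0$, $W\ne V$. It is known that $d=\delta$; this common value is the diameter. Orderings of eigenspaces as in (ii), (iii) are called standard, and an ordering of the eigenvalues of $A$ (resp. $A^*$) is called standard when the corresponding ordering of eigenspaces is standard. Under the $q$-Serre relations, standard orderings of the form $\theta_i=aq^{2i-d}$ and $\theta_i^*=a^*q^{d-2i}$ are known to exist. Split decomposition: it is known that, given standard orderings $\theta_0,\ldots,\theta_d$ and $\theta_0^*,\ldots,\theta_d^*$ of the eigenvalues of $A$ and $A^*$, there is a unique sequence $U_0,\ldots,U_d$ of subspaces of $V$ such that $V=U_0+U_1+\cdots+U_d$ (direct sum), $(A-\theta_iI)U_i\subseteq U_{i+1}$ for $0\le i<d$, $(A-\theta_dI)U_d=0$, $(A^*-\theta^*_iI)U_i\subseteq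 U_{i-1}$ for $0<i\le d$, and $(A^*-\theta^*_0I)U_0=0$. This sequence is the split decomposition with respect to these orderings. Raising and lowering maps: for $0\le i\le d$ let $F_i:V\to V$ be the projection onto $U_i$, i.e. $(F_i-I)U_i=0$ and $F_iU_j=0$ for $j\ne i$. Then $R=A-\sum_{h=0}^d\theta_hF_h$ is the raising map and $L=A^*-\sum_{h=0}^d\theta^*_hF_h$ is the lowering map. For $n=0$ the displayed vector is $v$. The exponents alternate: $L$ carries the odd-indexed exponents and $R$ carries the even-indexed exponents. *)

theory Defs
  imports "HOL-Library.Set_Algebras" "HOL-Computational_Algebra.Polynomial"
begin

text \<open>
  The space \<open>V\<close> is the whole carrier type of a vector space with scalar multiplication
  \<open>scale\<close>; linear transformations are functions satisfying the library predicate
  \<open>Vector_Spaces.linear scale scale\<close>. Sums of subspaces are the pointwise sums of sets from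
  \<open>HOL-Library.Set_Algebras\<close>.
\<close>

definition q_number :: "'k::field \<Rightarrow> nat \<Rightarrow> 'k" where
  "q_number q n = (q powi int n - q powi (- int n)) / (q - q powi (-1))"

text \<open>\<open>alternating_word f g [i\<^sub>1, i\<^sub>2, i\<^sub>3, \<dots>] v\<close> is \<open>f\<^bsup>i\<^sub>1\<^esup> g\<^bsup>i\<^sub>2\<^esup> f\<^bsup>i\<^sub>3\<^esup> \<dots> v\<close>;
  the roles of \<open>f\<close> and \<open>g\<close> are swapped in the recursive call.\<close>

fun alternating_word :: "('v \<Rightarrow> 'v) \<Rightarrow> ('v \<Rightarrow> 'v) \<Rightarrow> nat list \<Rightarrow> 'v \<Rightarrow> 'v" where
  "alternating_word f g [] v = v"
| "alternating_word f g (i # is) v = (f ^^ i) (alternating_word g f is v)"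

definition eigenspace ::
    "('k::field \<Rightarrow> 'v::ab_group_add \<Rightarrow> 'v) \<Rightarrow>
      ('v \<Rightarrow> 'v) \<Rightarrow> 'k \<Rightarrow> 'v set" where
  "eigenspace scale T \<theta> = {v. T v = scale \<theta> v}"

definition eigenvalues ::
    "('k::field \<Rightarrow> 'v::ab_group_add \<Rightarrow> 'v) \<Rightarrow>
      ('v \<Rightarrow> 'v) \<Rightarrow> 'k set" where
  "eigenvalues scale T = {\<theta>. \<exists>v. v \<noteq> 0 \<and> T v = scale \<theta> v}"

definition eigenspaces ::
    "('k::field \<Rightarrow> 'v::ab_group_add \<Rightarrow> 'v) \<Rightarrow>
      ('v \<Rightarrow> 'v) \<Rightarrow> 'v set set" where
  "eigenspaces scale T = eigenspace scale T ` eigenvalues scale T"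

definition diagonalizable ::
    "('k::field \<Rightarrow> 'v::ab_group_add \<Rightarrow> 'v) \<Rightarrow>
      ('v \<Rightarrow> 'v) \<Rightarrow> bool" where
  "diagonalizable scale T \<longleftrightarrow> module.span scale (\<Union> (eigenspaces scale T)) = UNIV"

text \<open>The conditionals encode the conventions \<open>V\<^bsub>-1\<^esub> = V\<^bsub>d+1\<^esub> = 0\<close>.\<close>

definition standard_eigenspace_ordering ::
    "('k::field \<Rightarrow> 'v::ab_group_add \<Rightarrow> 'v) \<Rightarrow>
      ('v \<Rightarrow> 'v) \<Rightarrow> ('v \<Rightarrow> 'v) \<Rightarrow> nat \<Rightarrow> (nat \<Rightarrow> 'v set) \<Rightarrow> bool" where
  "standard_eigenspace_ordering scale A B d W \<longleftrightarrow>
     bij_betw W {..d} (eigenspaces scale A) \<and>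
     (\<forall>i\<le>d. B ` W i \<subseteq>
        (if i = 0 then {0} else W (i - 1)) + W i + (if i = d then {0} else W (i + 1)))"

definition standard_eigenvalue_ordering ::
    "('k::field \<Rightarrow> 'v::ab_group_add \<Rightarrow> 'v) \<Rightarrow>
      ('v \<Rightarrow> 'v) \<Rightarrow> ('v \<Rightarrow> 'v) \<Rightarrow> nat \<Rightarrow> (nat \<Rightarrow> 'k) \<Rightarrow> bool" where
  "standard_eigenvalue_ordering scale A B d \<theta> \<longleftrightarrow>
     bij_betw \<theta> {..d} (eigenvalues scale A) \<and>
     standard_eigenspace_ordering scale A B d (\<lambda>i. eigenspace scale A (\<theta> i))"

definition tridiagonal_pair ::
    "('k::field \<Rightarrow> 'v::ab_group_add \<Rightarrow> 'v) \<Rightarrow>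
      ('v \<Rightarrow> 'v) \<Rightarrow> ('v \<Rightarrow> 'v) \<Rightarrow> bool" where
  "tridiagonal_pair scale A B \<longleftrightarrow>
     Vector_Spaces.linear scale scale A \<and> Vector_Spaces.linear scale scale B \<and>
     diagonalizable scale A \<and> diagonalizable scale B \<and>
     (\<exists>d W. standard_eigenspace_ordering scale A B d W) \<and>
     (\<exists>\<delta> W. standard_eigenspace_ordering scale B A \<delta> W) \<and>
     \<not> (\<exists>W. module.subspace scale W \<and> A ` W \<subseteq> W \<and> B ` W \<subseteq> W \<and> W \<noteq> {0} \<and> W \<noteq> UNIV)"

text \<open>The diameter is the common value of the two lengths \<open>d\<close> and \<open>\<delta>\<close> above.\<close>

definition tridiagonal_pair_of_diameter ::
    "('k::field \<Rightarrow> 'v::ab_group_add \<Rightarrow> 'v) \<Rightarrow>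
      ('v \<Rightarrow> 'v) \<Rightarrow> ('v \<Rightarrow> 'v) \<Rightarrow> nat \<Rightarrow> bool" where
  "tridiagonal_pair_of_diameter scale A B d \<longleftrightarrow>
     tridiagonal_pair scale A B \<and>
     (\<exists>W. standard_eigenspace_ordering scale A B d W) \<and>
     (\<exists>W. standard_eigenspace_ordering scale B A d W)"

definition q_Serre_relation ::
    "('k::field \<Rightarrow> 'v::ab_group_add \<Rightarrow> 'v) \<Rightarrow>
      'k \<Rightarrow> ('v \<Rightarrow> 'v) \<Rightarrow> ('v \<Rightarrow> 'v) \<Rightarrow> bool" where
  "q_Serre_relation scale q A B \<longleftrightarrow>
     (\<forall>v. (A ^^ 3) (B v) - scale (q_number q 3) ((A ^^ 2) (B (A v)))
        + scale (q_number q 3) (A (B ((A ^^ 2) v))) - B ((A ^^ 3) v) = 0)"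

definition direct_sum_decomposition ::
    "('k::field \<Rightarrow> 'v::ab_group_add \<Rightarrow> 'v) \<Rightarrow>
      nat \<Rightarrow> (nat \<Rightarrow> 'v set) \<Rightarrow> bool" where
  "direct_sum_decomposition scale d U \<longleftrightarrow>
     (\<forall>i\<le>d. module.subspace scale (U i)) \<and>
     (\<Sum>i\<le>d. U i) = UNIV \<and>
     (\<forall>u. (\<forall>i\<le>d. u i \<in> U i) \<and> (\<Sum>i\<le>d. u i) = 0 \<longrightarrow> (\<forall>i\<le>d. u i = 0))"

definition split_decomposition ::
    "('k::field \<Rightarrow> 'v::ab_group_add \<Rightarrow> 'v) \<Rightarrow>
      ('v \<Rightarrow> 'v) \<Rightarrow> ('v \<Rightarrow> 'v) \<Rightarrow> nat \<Rightarrow> (nat \<Rightarrow> 'k) \<Rightarrow> (nat \<Rightarrow> 'k) \<Rightarrow> (nat \<Rightarrow> 'v set) \<Rightarrow> bool" where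
  "split_decomposition scale A B d \<theta> \<theta>s U \<longleftrightarrow>
     direct_sum_decomposition scale d U \<and>
     (\<forall>i<d. (\<lambda>u. A u - scale (\<theta> i) u) ` U i \<subseteq> U (i + 1)) \<and>
     (\<lambda>u. A u - scale (\<theta> d) u) ` U d = {0} \<and>
     (\<forall>i. 0 < i \<and> i \<le> d \<longrightarrow> (\<lambda>u. B u - scale (\<theta>s i) u) ` U i \<subseteq> U (i - 1)) \<and>
     (\<lambda>u. B u - scale (\<theta>s 0) u) ` U 0 = {0}"

definition is_projection ::
    "('k::field \<Rightarrow> 'v::ab_group_add \<Rightarrow> 'v) \<Rightarrow>
      nat \<Rightarrow> (nat \<Rightarrow> 'v set) \<Rightarrow> nat \<Rightarrow> ('v \<Rightarrow> 'v) \<Rightarrow> bool" where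
  "is_projection scale d U i F \<longleftrightarrow>
     Vector_Spaces.linear scale scale F \<and> (\<forall>u\<in>U i. F u = u) \<and> (\<forall>j\<le>d. j \<noteq> i \<longrightarrow> (\<forall>u\<in>U j. F u = 0))"

text \<open>The definite description is well defined for direct sum decompositions; see
  \<open>is_projection_projection\<close> and \<open>projection_eqI\<close> below.\<close>

definition projection ::
    "('k::field \<Rightarrow> 'v::ab_group_add \<Rightarrow> 'v) \<Rightarrow>
      nat \<Rightarrow> (nat \<Rightarrow> 'v set) \<Rightarrow> nat \<Rightarrow> 'v \<Rightarrow> 'v" where
  "projection scale d U i = (THE F. is_projection scale d U i F)"

definition raising_map ::
    "('k::field \<Rightarrow> 'v::ab_group_add \<Rightarrow> 'v) \<Rightarrow>
      ('v \<Rightarrow> 'v) \<Rightarrow> nat \<Rightarrow> (nat \<Rightarrow> 'k) \<Rightarrow> (nat \<Rightarrow> 'v set) \<Rightarrow> 'v \<Rightarrow> 'v" where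
  "raising_map scale A d \<theta> U = (\<lambda>v. A v - (\<Sum>h\<le>d. scale (\<theta> h) (projection scale d U h v)))"

definition lowering_map ::
    "('k::field \<Rightarrow> 'v::ab_group_add \<Rightarrow> 'v) \<Rightarrow>
      ('v \<Rightarrow> 'v) \<Rightarrow> nat \<Rightarrow> (nat \<Rightarrow> 'k) \<Rightarrow> (nat \<Rightarrow> 'v set) \<Rightarrow> 'v \<Rightarrow> 'v" where
  "lowering_map scale B d \<theta>s U = (\<lambda>v. B v - (\<Sum>h\<le>d. scale (\<theta>s h) (projection scale d U h v)))"

lemma direct_sum_components:
  assumes "direct_sum_decomposition scale d U"
  obtains u where "\<And>i. i \<le> d \<Longrightarrow> u i \<in> U i" "v = (\<Sum>i\<le>d. u i)"
proof -
  have "v \<in> (\<Sum>i\<le>d. U i)"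
    using assms by (simp add: direct_sum_decomposition_def)
  then obtain u where "\<forall>i\<in>{..d}. u i \<in> U i" "v = sum u {..d}"
    by (auto simp: set_sum_alt)
  then show thesis
    using that[of u] by auto
qed

lemma is_projection_sum:
  assumes F: "is_projection scale d U i F" and i: "i \<le> d" and u: "\<And>j. j \<le> d \<Longrightarrow> u j \<in> U j"
  shows "F (\<Sum>j\<le>d. u j) = u i"
proof -
  interpret F: Vector_Spaces.linear scale scale F
    using F by (simp add: is_projection_def)
  have "F (\<Sum>j\<le>d. u j) = (\<Sum>j\<le>d. if j = i then u i else 0)"
    unfolding F.sum using F u by (intro sum.cong) (auto simp: is_projection_def)
  then show ?thesis using i by simp
qed

lemma is_projection_unique:
  assumes U: "direct_sum_decomposition scale d U" and i: "i \<le> d"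
    and F: "is_projection scale d U i F" and G: "is_projection scale d U i G"
  shows "F = G"
proof
  fix v
  obtain u where u: "\<And>i. i \<le> d \<Longrightarrow> u i \<in> U i" "v = (\<Sum>i\<le>d. u i)"
    using direct_sum_components[OF U] by metis
  have "F v = u i"
    unfolding u(2) by (rule is_projection_sum[OF F i]) (rule u(1))
  moreover have "G v = u i"
    unfolding u(2) by (rule is_projection_sum[OF G i]) (rule u(1))
  ultimately show "F v = G v" by simp
qed

lemma is_projection_exists:
  assumes vs: "vector_space scale"
    and U: "direct_sum_decomposition scale d U" and i: "i \<le> d"
  shows "\<exists>F. is_projection scale d U i F"
proof -
  interpret vs: vector_space scale by (fact vs)
  have "\<forall>v. \<exists>u. (\<forall>j\<le>d. u j \<in> U j) \<and> v = (\<Sum>j\<le>d. u j)"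
    using direct_sum_components[OF U] by metis
  then obtain c where c: "\<And>v j. j \<le> d \<Longrightarrow> c v j \<in> U j" "\<And>v. v = (\<Sum>j\<le>d. c v j)"
    by metis
  have sub: "module.subspace scale (U j)" if "j \<le> d" for j
    using U that by (simp add: direct_sum_decomposition_def)
  have uniq: "c v j = w j" if w: "\<And>j. j \<le> d \<Longrightarrow> w j \<in> U j" "v = (\<Sum>j\<le>d. w j)" and "j \<le> d" for v w j
  proof -
    have "(\<Sum>j\<le>d. c v j - w j) = 0"
      using c(2)[of v] w(2) by (simp add: sum_subtractf)
    moreover have "c v j - w j \<in> U j" if "j \<le> d" for j
      using sub c(1) w(1) that by (simp add: vs.subspace_diff)
    moreover have "\<forall>u. (\<forall>i\<le>d. u i \<in> U i) \<and> (\<Sum>i\<le>d. u i) = 0 \<longrightarrow> (\<forall>i\<le>d. u i = 0)"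
      using U by (simp add: direct_sum_decomposition_def)
    ultimately have "\<forall>j\<le>d. c v j - w j = 0"
      by (auto dest!: spec[of _ "\<lambda>j. c v j - w j"])
    with \<open>j \<le> d\<close> show ?thesis by simp
  qed
  have add: "c (x + y) i = c x i + c y i" for x y
    using c(1) c(2)[of x] c(2)[of y] sub i
    by (intro uniq[where w = "\<lambda>j. c x j + c y j"]) (auto simp: sum.distrib intro: vs.subspace_add)
  have scl: "c (scale r x) i = scale r (c x i)" for r x
    using c(1) c(2)[of x] sub i
    by (intro uniq[where w = "\<lambda>j. scale r (c x j)"])
      (auto simp: vs.scale_sum_right[symmetric] intro: vs.subspace_scale)
  have comp: "c x i = (if i = k then x else 0)" if "k \<le> d" "x \<in> U k" for x k
    using that sub i
    by (intro uniq[where w = "\<lambda>j. if j = k then x else 0"]) (auto intro: vs.subspace_0)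
  have "Vector_Spaces.linear scale scale (\<lambda>v. c v i)"
    by unfold_locales (simp_all add: add scl vs.scale_right_distrib vs.scale_left_distrib)
  then have "is_projection scale d U i (\<lambda>v. c v i)"
    using comp i by (auto simp: is_projection_def)
  then show ?thesis by blast
qed

lemma is_projection_projection:
  assumes "vector_space scale" "direct_sum_decomposition scale d U" "i \<le> d"
  shows "is_projection scale d U i (projection scale d U i)"
  unfolding projection_def
  using is_projection_exists[OF assms] is_projection_unique[OF assms(2,3)] by (metis theI)

lemma projection_eqI:
  assumes "vector_space scale" "direct_sum_decomposition scale d U" "i \<le> d"
    and "is_projection scale d U i F"
  shows "projection scale d U i = F"
  using assms is_projection_projection is_projection_unique by metis

end

theory Submission
  imports Defs
begin

text \<open>
  Put \<open>p = q\<^sup>2\<close>, and for maps \<open>x, Y\<close> and a scalar \<open>c\<close> call \<open>Y x - c x Y\<close> a twisted commutator. On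
  \<open>U i\<close> the maps \<open>A\<close> and \<open>As\<close> are \<open>R\<close> and \<open>L\<close> plus scalars, and the components of degree \<open>2\<close> and \<open>-2\<close> of
  the two given relations say that \<open>R, L\<close> satisfy the \<open>q\<close>-Serre relations themselves
  (\<open>raising_lowering_q_Serre\<close>). A \<open>q\<close>-Serre relation for \<open>x, y\<close> says that \<open>y\<close> is killed by the
  composite of the three twisted commutators with scalars \<open>p\<^bsup>-1\<^esup>, 1, p\<close>. This implies that \<open>y\<^sup>n\<close> is
  killed by the composite of those with scalars \<open>p\<^bsup>-n\<^esup>, \<dots>, p\<^bsup>n\<^esup>\<close> (\<open>higher_q_Serre\<close>). Consequently, for
  fixed \<open>N\<close>, the map \<open>e \<mapsto> x\<^bsup>N-e\<^esup> y\<^sup>n x\<^sup>e\<close> obeys every linear relation that holds for the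
  \<open>2n+1\<close> geometric sequences \<open>e \<mapsto> p\<^bsup>je\<^esup>\<close>, \<open>-n \<le> j \<le> n\<close>; since \<open>p\<close> is not a root of unity, any \<open>2n+1\<close>
  of its values determine all the others (\<open>exchange_relation\<close>). Two consequences carry the proof.

  First, on \<open>U 0\<close> the maps \<open>L\<^sup>i R\<^sup>i\<close> commute (\<open>return_maps_commute\<close>). As the field is algebraically closed,
  they have a common eigenvector \<open>w \<in> U 0\<close> (\<open>common_eigenvector_exists\<close>).

  Second, in a word \<open>\<dots> x\<^sup>r y\<^sup>s x\<^sup>t \<dots>\<close> with \<open>r \<ge> s < t\<close> the factor \<open>x\<^sup>r y\<^sup>s x\<^sup>t\<close> can be rewritten in terms
  of \<open>x\<^bsup>r'\<^esup> y\<^sup>s x\<^bsup>t'\<^esup>\<close> with \<open>r' < s\<close> or \<open>t' \<le> s\<close>. This rewriting terminates, and it stops only at words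
  whose exponents first increase and then weakly decrease. If there is a descent at the end,
  \<open>L\<^sup>r R\<^sup>s w\<close> with \<open>r \<ge> s\<close>, then it is \<open>0\<close> for \<open>r > s\<close> and a multiple of \<open>w\<close> for \<open>r = s\<close>, so it can be
  deleted, and so on. Hence the increasing words span everything that all words in \<open>L, R\<close> reach from \<open>w\<close> (\<open>alternating_word_in_span_increasing\<close>). That space is
  homogeneous and invariant under \<open>L\<close> and \<open>R\<close>, so it is invariant under \<open>A\<close> and \<open>As\<close>, and irreducibility
  makes it the whole of \<open>V\<close>.

  This settles the claim for \<open>w\<close>. A nonempty increasing word raises the degree strictly, so the only
  increasing word with a component in \<open>U 0\<close> is \<open>w\<close> itself. Therefore \<open>U 0\<close> is the line through \<open>w\<close>, and
  every nonzero \<open>v \<in> U 0\<close> serves equally well.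
\<close>

section \<open>Interpolation at geometric nodes\<close>

lemma lagrange_interpolation:
  fixes W :: "'a::field set"
  assumes "finite W"
  obtains l where "\<And>P. degree P < card W \<Longrightarrow> poly P x = (\<Sum>w\<in>W. l w * poly P w)"
proof
  define b where "b w = (\<Prod>w'\<in>W - {w}. [:- w', 1:])" for w :: 'a
  have b_self: "poly (b w) w \<noteq> 0" if "w \<in> W" for w
    using assms that by (auto simp: b_def poly_prod)
  have b_other: "poly (b w) w' = 0" if "w' \<in> W" "w \<noteq> w'" for w w'
    using assms that by (auto simp: b_def poly_prod)
  have b_deg: "degree (b w) < card W" if "w \<in> W" for w
  proof -
    have "degree (b w) = card (W - {w})"
      unfolding b_def by (subst degree_prod_sum_eq) auto
    then show ?thesis
      using assms that card_gt_0_iff[of W] by auto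
  qed
  show "poly P x = (\<Sum>w\<in>W. (poly (b w) x / poly (b w) w) * poly P w)"
    if deg: "degree P < card W" for P
  proof -
    define S where "S = (\<Sum>w\<in>W. smult (poly P w / poly (b w) w) (b w))"
    have "degree S < card W"
      unfolding S_def using deg b_deg
      by (intro degree_sum_less) (auto intro: le_less_trans[OF degree_smult_le])
    moreover have "poly P w = poly S w" if "w \<in> W" for w
    proof -
      have "poly S w = (\<Sum>w'\<in>W. if w' = w then poly P w else 0)"
        unfolding S_def poly_sum using b_self b_other that by (intro sum.cong) auto
      then show ?thesis using assms that by simp
    qed
    ultimately have "P = S"
      using deg by (intro poly_eqI_degree[where A = W]) auto
    then have "poly P x = poly S x" by simp
    also have "\<dots> = (\<Sum>w\<in>W. (poly (b w) x / poly (b w) w) * poly P w)"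
      by (simp add: S_def poly_sum mult.commute)
    finally show ?thesis .
  qed
qed

lemma power_inj_not_root_of_unity:
  fixes p :: "'a::field"
  assumes "p \<noteq> 0" and "\<And>n::nat. n > 0 \<Longrightarrow> p ^ n \<noteq> 1"
  shows "p ^ i = p ^ j \<longleftrightarrow> i = j"
proof (induction i j rule: linorder_wlog)
  case (le i j)
  have "p ^ j = p ^ i * p ^ (j - i)"
    using le by (simp flip: power_add)
  then show ?case
    using assms(1) assms(2)[of "j - i"] le by (cases "i = j") auto
qed auto

text \<open>
  For \<open>i \<le> 2n\<close> these are the \<open>2n+1\<close> scalars \<open>p\<^bsup>-n\<^esup>, \<dots>, p\<^bsup>n\<^esup>\<close>, the roots of the \<open>n\<close>-th higher
  \<open>q\<close>-Serre relation. Indexing them from \<open>0\<close> makes them available as lists \<open>map _ [0..<2n+1]\<close>.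
\<close>
definition serre_node :: "'a::field \<Rightarrow> nat \<Rightarrow> nat \<Rightarrow> 'a" where
  "serre_node p n i = p powi (int i - int n)"

lemma serre_node_alt: "p \<noteq> 0 \<Longrightarrow> serre_node p n i = p ^ i / p ^ n"
  by (simp add: serre_node_def power_int_diff)

text \<open>
  The coefficients of a monomial \<open>z\<^bsup>e0\<^esup>\<close> in terms of the \<open>z\<^sup>e\<close>, \<open>e \<in> E\<close>, as functions on the nodes.
\<close>
definition exchange_coeffs :: "'a::field \<Rightarrow> nat \<Rightarrow> nat \<Rightarrow> nat set \<Rightarrow> (nat \<Rightarrow> 'a) \<Rightarrow> bool" where
  "exchange_coeffs p n e0 E c \<longleftrightarrow>
     (\<forall>i\<le>2 * n. serre_node p n i ^ e0 = (\<Sum>e\<in>E. c e * serre_node p n i ^ e))"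

text \<open>
  The generalized Vandermonde matrix \<open>p\<^bsup>je\<^esup>\<close> with \<open>-n \<le> j \<le> n\<close> and \<open>e \<in> E\<close> is an ordinary Vandermonde
  matrix in the distinct numbers \<open>p\<^sup>e\<close>. So exchanging the roles of nodes and exponents turns the claim
  into Lagrange interpolation of the monomials of degree at most \<open>2n\<close> at the points \<open>p\<^sup>e\<close>.
\<close>
lemma exchange_coeffs_exist:
  fixes p :: "'a::field"
  assumes p: "p \<noteq> 0" "\<And>n::nat. n > 0 \<Longrightarrow> p ^ n \<noteq> 1"
    and E: "finite E" "card E = 2 * n + 1"
  obtains c where "exchange_coeffs p n e0 E c"
proof -
  have inj: "inj_on (\<lambda>e. p ^ e) E"
    using power_inj_not_root_of_unity[OF p] by (auto simp: inj_on_def)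
  obtain l where l: "\<And>P. degree P < card ((\<lambda>e. p ^ e) ` E) \<Longrightarrow>
      poly P (p ^ e0) = (\<Sum>w\<in>(\<lambda>e. p ^ e) ` E. l w * poly P w)"
    using lagrange_interpolation[of "(\<lambda>e. p ^ e) ` E"] E(1) by blast
  \<comment> \<open>The nodes carry exponents from \<open>-n\<close>, the interpolated monomials from \<open>0\<close>; the powers
    \<open>p\<^bsup>ne\<^esup>\<close> make up for the shift.\<close>
  have "serre_node p n i ^ e0 = (\<Sum>e\<in>E. (l (p ^ e) * p ^ (n * e) / p ^ (n * e0)) * serre_node p n i ^ e)"
    if "i \<le> 2 * n" for i
  proof -
    have "poly (monom 1 i) (p ^ e0) = (\<Sum>w\<in>(\<lambda>e. p ^ e) ` E. l w * poly (monom 1 i) w)"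
      using that inj E by (intro l) (simp add: card_image degree_monom_eq)
    also have "\<dots> = (\<Sum>e\<in>E. l (p ^ e) * (p ^ e) ^ i)"
      by (simp add: sum.reindex[OF inj] poly_monom)
    finally have *: "p ^ (i * e0) = (\<Sum>e\<in>E. l (p ^ e) * p ^ (i * e))"
      by (simp add: poly_monom mult.commute flip: power_mult)
    have "serre_node p n i ^ e0 = p ^ (i * e0) / p ^ (n * e0)"
      using p(1) by (simp add: serre_node_alt power_divide flip: power_mult)
    also have "\<dots> = (\<Sum>e\<in>E. l (p ^ e) * p ^ (i * e) / p ^ (n * e0))"
      unfolding * by (simp add: sum_divide_distrib)
    also have "\<dots> = (\<Sum>e\<in>E. (l (p ^ e) * p ^ (n * e) / p ^ (n * e0)) * serre_node p n i ^ e)"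
      using p(1) by (intro sum.cong) (auto simp: serre_node_alt power_divide simp flip: power_mult)
    finally show ?thesis .
  qed
  then show thesis
    using that[of "\<lambda>e. l (p ^ e) * p ^ (n * e) / p ^ (n * e0)"] by (auto simp: exchange_coeffs_def)
qed

text \<open>
  The set of nodes is closed under inversion, so relations between exponents survive \<open>e \<mapsto> N - e\<close>.
\<close>
lemma exchange_coeffs_reflect:
  fixes p :: "'a::field"
  assumes p: "p \<noteq> 0" and E: "E \<subseteq> {..N}" "e0 \<le> N" and c: "exchange_coeffs p n e0 E c"
  shows "exchange_coeffs p n (N - e0) ((\<lambda>e. N - e) ` E) (\<lambda>e. c (N - e))"
  unfolding exchange_coeffs_def
proof (intro allI impI)
  fix i assume i: "i \<le> 2 * n"
  let ?z = "serre_node p n i" and ?z' = "serre_node p n (2 * n - i)"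
  have z: "?z * ?z' = 1"
    using i p by (simp add: serre_node_alt power_add[symmetric] mult_2)
  have refl: "?z ^ (N - e) = ?z ^ N * ?z' ^ e" if "e \<le> N" for e
  proof -
    have "?z ^ N * ?z' ^ e = ?z ^ (N - e) * (?z * ?z') ^ e"
      using that by (simp add: power_mult_distrib mult.assoc[symmetric] flip: power_add)
    then show ?thesis by (simp add: z)
  qed
  have inj: "inj_on (\<lambda>e. N - e) E"
    using E(1) by (auto simp: inj_on_def subset_iff) (metis diff_diff_cancel)
  have "?z ^ (N - e0) = ?z ^ N * (\<Sum>e\<in>E. c e * ?z' ^ e)"
    using refl[OF E(2)] c i by (auto simp: exchange_coeffs_def)
  also have "\<dots> = (\<Sum>e\<in>E. c e * ?z ^ (N - e))"
    unfolding sum_distrib_left using E(1) refl by (intro sum.cong) auto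
  also have "\<dots> = (\<Sum>e\<in>(\<lambda>e. N - e) ` E. c (N - e) * ?z ^ e)"
    unfolding sum.reindex[OF inj] using E(1) by (intro sum.cong) auto
  finally show "?z ^ (N - e0) = (\<Sum>e\<in>(\<lambda>e. N - e) ` E. c (N - e) * ?z ^ e)" .
qed

section \<open>Twisted commutators and the higher q-Serre relations\<close>

lemma q_number_3:
  fixes q :: "'a::field"
  assumes "q \<noteq> 0" "q ^ 2 \<noteq> 1"
  shows "q_number q 3 = q ^ 2 + 1 + inverse (q ^ 2)"
proof -
  have "q - inverse q \<noteq> 0"
    using assms by (auto simp: field_simps power2_eq_square)
  then show ?thesis
    using assms(1) by (simp add: q_number_def power_int_minus divide_simps) algebra
qed

text \<open>
  Library theories interpret \<open>vector_space\<close> globally for real vector spaces. A separate locale keeps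
  the constants and facts below from being instantiated there.
\<close>
locale endomorphisms = vector_space scale
  for scale :: "'a::field \<Rightarrow> 'b::ab_group_add \<Rightarrow> 'b" (infixr \<open>*s\<close> 75)
begin

abbreviation endo :: "('b \<Rightarrow> 'b) \<Rightarrow> bool" where
  "endo f \<equiv> Vector_Spaces.linear scale scale f"

lemma endo_add: "endo f \<Longrightarrow> f (u + v) = f u + f v"
  and endo_scale: "endo f \<Longrightarrow> f (c *s u) = c *s f u"
  by (simp_all add: linear_iff_module_hom module_hom.add module_hom.scale)

lemma endo_0: "endo f \<Longrightarrow> f 0 = 0"
  and endo_diff: "endo f \<Longrightarrow> f (u - v) = f u - f v"
  and endo_sum: "endo f \<Longrightarrow> f (sum g S) = (\<Sum>i\<in>S. f (g i))"
  by (simp_all add: linear_iff_module_hom module_hom.zero module_hom.diff module_hom.sum)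

lemmas endo_simps = endo_add endo_scale endo_0 endo_diff endo_sum

lemma endoI:
  assumes "\<And>u v. f (u + v) = f u + f v" and "\<And>c u. f (c *s u) = c *s f u"
  shows "endo f"
  by (simp add: Vector_Spaces.linear_def module_hom_def module_hom_axioms_def vector_space_axioms
      module_axioms assms)

lemma endo_minus: "endo f \<Longrightarrow> endo g \<Longrightarrow> endo (\<lambda>u. f u - g u)"
  by (intro endoI) (auto simp: endo_simps scale_right_diff_distrib)

lemma endo_funpow: "endo f \<Longrightarrow> endo (f ^^ n)"
  by (induction n) (auto intro!: endoI simp: endo_simps)

definition twist :: "('b \<Rightarrow> 'b) \<Rightarrow> 'a \<Rightarrow> ('b \<Rightarrow> 'b) \<Rightarrow> 'b \<Rightarrow> 'b" where
  "twist x c Y = (\<lambda>v. Y (x v) - c *s x (Y v))"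

lemma endo_twist: "endo x \<Longrightarrow> endo Y \<Longrightarrow> endo (twist x c Y)"
  by (intro endoI) (auto simp: twist_def endo_simps scale_right_distrib scale_right_diff_distrib
      scale_left_commute)

lemma fold_twist_lincomb:
  assumes "endo x"
  shows "fold (twist x) cs (\<lambda>v. Y v + b *s Z v) = (\<lambda>v. fold (twist x) cs Y v + b *s fold (twist x) cs Z v)"
proof (induction cs arbitrary: Y Z)
  case (Cons c cs)
  have "twist x c (\<lambda>v. Y v + b *s Z v) = (\<lambda>v. twist x c Y v + b *s twist x c Z v)"
    using assms by (auto simp: twist_def fun_eq_iff endo_simps algebra_simps scale_left_commute)
  then show ?case using Cons.IH by simp
qed auto

lemma endo_fold_twist: "endo x \<Longrightarrow> endo Y \<Longrightarrow> endo (fold (twist x) cs Y)"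
  by (induction cs arbitrary: Y) (auto simp: endo_twist)

text \<open>
  The identity behind this is
  \<open>(Y Z) x - a b x (Y Z) = Y (Z x - b x Z) + b (Y x - a x Y) Z\<close>:
  a twisted commutator of a product is distributed to either factor if its scalar splits accordingly.
  After \<open>T\<close> of them each summand has received \<open>k\<close> on the left and \<open>T - k\<close> on the right, in the
  prescribed order since \<open>c (i + j) = a i * b j\<close>. By \<open>M + N \<le> T + 1\<close> either the left factor has received
  \<open>M\<close> or the right factor has received \<open>N\<close>.
\<close>
lemma fold_twist_comp_zero:
  fixes a b c :: "nat \<Rightarrow> 'a"
  assumes x: "endo x" and Y: "endo Y"
    and c: "\<And>i j. c (i + j) = a i * b j"
    and Y0: "fold (twist x) (map a [0..<M]) Y = (\<lambda>_. 0)"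
    and Z0: "fold (twist x) (map b [0..<N]) Z = (\<lambda>_. 0)"
    and MN: "M + N \<le> Suc T"
  shows "fold (twist x) (map c [0..<T]) (\<lambda>v. Y (Z v)) = (\<lambda>_. 0)"
proof -
  define Yf where "Yf k = fold (twist x) (map a [0..<k]) Y" for k
  define Zf where "Zf k = fold (twist x) (map b [0..<k]) Z" for k
  have Y_Suc: "Yf (Suc k) = twist x (a k) (Yf k)" for k by (simp add: Yf_def)
  have Z_Suc: "Zf (Suc k) = twist x (b k) (Zf k)" for k by (simp add: Zf_def)
  have Y_endo: "endo (Yf k)" for k
    using x Y by (simp add: Yf_def endo_fold_twist)
  have Y_zero: "Yf k = (\<lambda>_. 0)" if "M \<le> k" for k
    using that by (induction rule: dec_induct) (use Y0 x in \<open>auto simp: Yf_def twist_def endo_simps\<close>)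
  have Z_zero: "Zf k = (\<lambda>_. 0)" if "N \<le> k" for k
    using that by (induction rule: dec_induct) (use Z0 x in \<open>auto simp: Zf_def twist_def endo_simps\<close>)
  have "fold (twist x) (map c [k + r..<T]) (\<lambda>v. Yf k (Zf r v)) = (\<lambda>_. 0)" if "k + r \<le> T" for k r
    using that
  proof (induction "T - (k + r)" arbitrary: k r)
    case 0
    then have "M \<le> k \<or> N \<le> r" using MN by linarith
    then show ?case
      using 0 Y_zero Z_zero Y_endo[of k] by (auto simp: endo_simps)
  next
    case (Suc t)
    have split: "twist x (c (k + r)) (\<lambda>v. Yf k (Zf r v)) =
        (\<lambda>v. Yf k (Zf (Suc r) v) + b r *s Yf (Suc k) (Zf r v))"
      using Y_endo[of k]
      by (auto simp: twist_def Y_Suc Z_Suc c fun_eq_iff endo_simps scale_right_diff_distrib mult.commute)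
    have "[k + r..<T] = (k + r) # [Suc (k + r)..<T]"
      using Suc by (simp add: upt_conv_Cons)
    then show ?case
      using Suc(1)[of k "Suc r"] Suc(1)[of "Suc k" r] Suc(2,3) x
      by (simp add: split fold_twist_lincomb)
  qed
  from this[of 0 0] show ?thesis by (simp add: Yf_def Zf_def)
qed

text \<open>
  The cubic \<open>z\<^sup>3 - [3] z\<^sup>2 + [3] z - 1\<close> has the roots \<open>q\<^bsup>-2\<^esup>, 1, q\<^sup>2\<close>.
\<close>
lemma q_Serre_iff_twist:
  assumes q: "q \<noteq> 0" "q ^ 2 \<noteq> 1" and x: "endo x" and y: "endo y"
  shows "q_Serre_relation scale q x y \<longleftrightarrow>
    fold (twist x) (map (serre_node (q ^ 2) 1) [0..<3]) y = (\<lambda>_. 0)"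
proof -
  have nodes: "map (serre_node (q ^ 2) 1) [0..<3] = [inverse (q ^ 2), 1, q ^ 2]"
    using q(1) by (simp add: serre_node_alt numeral_3_eq_3 upt_rec[of 0] upt_rec[of 1] upt_rec[of 2]
        field_simps power2_eq_square)
  have cube: "(x ^^ 3) u = x (x (x u))" and square: "(x ^^ 2) u = x (x u)" for u
    by (simp_all add: eval_nat_numeral)
  have "fold (twist x) [inverse (q ^ 2), 1, q ^ 2] y v =
     - ((x ^^ 3) (y v) - scale (q_number q 3) ((x ^^ 2) (y (x v)))
        + scale (q_number q 3) (x (y ((x ^^ 2) v))) - y ((x ^^ 3) v))" for v
    using x y q(1) by (simp add: twist_def endo_simps q_number_3[OF q] cube square algebra_simps)
  then show ?thesis
    unfolding q_Serre_relation_def nodes fun_eq_iff by (metis neg_equal_0_iff_equal)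
qed

text \<open>
  A special case of Lusztig's higher-order relations. In the induction step the scalars for \<open>y y\<^sup>n\<close>
  split as \<open>p\<^bsup>i+j-(n+1)\<^esup> = p\<^bsup>i-1\<^esup> p\<^bsup>j-n\<^esup>\<close>, and \<open>3 + (2n+1) = (2n+3) + 1\<close> is just enough for the preceding
  lemma.
\<close>
lemma higher_q_Serre:
  assumes p: "p \<noteq> 0" and x: "endo x" and y: "endo y"
    and serre: "fold (twist x) (map (serre_node p 1) [0..<3]) y = (\<lambda>_. 0)"
  shows "fold (twist x) (map (serre_node p n) [0..<2 * n + 1]) (y ^^ n) = (\<lambda>_. 0)"
proof (induction n)
  case 0
  show ?case by (simp add: twist_def serre_node_def fun_eq_iff)
next
  case (Suc n)
  have "serre_node p (Suc n) (i + j) = serre_node p 1 i * serre_node p n j" for i j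
    using p by (simp add: serre_node_alt power_add)
  from fold_twist_comp_zero[OF x y this serre Suc, of "2 * Suc n + 1"] show ?case
    by (simp only: funpow.simps comp_def) simp
qed

section \<open>Exchange relations\<close>

text \<open>
  The map \<open>z\<^sup>e \<mapsto> x\<^bsup>N-e\<^esup> Y x\<^sup>e\<close>, extended linearly to polynomials of degree at most \<open>N\<close>: the variable
  acts by multiplication with \<open>x\<close> on the right, and \<open>x\<close> on the left homogenizes.
\<close>
definition two_sided :: "('b \<Rightarrow> 'b) \<Rightarrow> ('b \<Rightarrow> 'b) \<Rightarrow> nat \<Rightarrow> 'a poly \<Rightarrow> 'b \<Rightarrow> 'b" where
  "two_sided x Y N P v = (\<Sum>e\<le>N. coeff P e *s (x ^^ (N - e)) (Y ((x ^^ e) v)))"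

lemma two_sided_root:
  assumes x: "endo x" and deg: "degree P \<le> N"
  shows "two_sided x Y (Suc N) ([:- c, 1:] * P) v = two_sided x (twist x c Y) N P v"
proof -
  have top: "coeff P (Suc N) = 0"
    using deg by (simp add: coeff_eq_0)
  have "two_sided x Y (Suc N) ([:- c, 1:] * P) v =
      (\<Sum>e\<le>Suc N. coeff (pCons 0 P) e *s (x ^^ (Suc N - e)) (Y ((x ^^ e) v)))
      - (\<Sum>e\<le>Suc N. (c * coeff P e) *s (x ^^ (Suc N - e)) (Y ((x ^^ e) v)))"
    by (simp add: two_sided_def algebra_simps sum_subtractf scale_left_diff_distrib sum.distrib
        sum_negf flip: scale_minus_left)
  also have "(\<Sum>e\<le>Suc N. coeff (pCons 0 P) e *s (x ^^ (Suc N - e)) (Y ((x ^^ e) v))) =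
      (\<Sum>e\<le>N. coeff P e *s (x ^^ (N - e)) (Y ((x ^^ e) (x v))))"
    by (subst sum.atMost_Suc_shift) (simp add: funpow_swap1)
  also have "(\<Sum>e\<le>Suc N. (c * coeff P e) *s (x ^^ (Suc N - e)) (Y ((x ^^ e) v))) =
      (\<Sum>e\<le>N. (c * coeff P e) *s (x ^^ (N - e)) (x (Y ((x ^^ e) v))))"
    by (simp add: top Suc_diff_le funpow_swap1)
  also have "(\<Sum>e\<le>N. coeff P e *s (x ^^ (N - e)) (Y ((x ^^ e) (x v)))) - \<dots> =
      two_sided x (twist x c Y) N P v"
    unfolding two_sided_def twist_def sum_subtractf[symmetric] using endo_funpow[OF x]
    by (intro sum.cong) (auto simp: endo_simps scale_right_diff_distrib funpow_swap1 mult.commute)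
  finally show ?thesis .
qed

text \<open>
  Split off the linear factors of \<open>D\<close> one at a time; each of them becomes a twisted commutator.
\<close>
lemma two_sided_vanishing:
  assumes x: "endo x"
    and "distinct cs" "\<And>c. c \<in> set cs \<Longrightarrow> poly D c = 0" "degree D \<le> N"
    and "fold (twist x) cs Y = (\<lambda>_. 0)"
  shows "two_sided x Y N D v = 0"
  using assms(2-)
proof (induction cs arbitrary: D N Y)
  case Nil
  then have "Y = (\<lambda>_. 0)" by simp
  with endo_funpow[OF x] show ?case by (simp add: two_sided_def endo_simps)
next
  case (Cons c cs)
  show ?case
  proof (cases "D = 0")
    case True
    then show ?thesis by (simp add: two_sided_def)
  next
    case False
    have "poly D c = 0" using Cons.prems by simp
    then obtain D' where D': "D = [:- c, 1:] * D'"
      by (auto simp: poly_eq_0_iff_dvd dvd_def)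
    with False have "D' \<noteq> 0" by auto
    then have "degree D = Suc (degree D')"
      unfolding D' by (subst degree_mult_eq) auto
    with Cons.prems(3) obtain N' where N: "N = Suc N'" "degree D' \<le> N'"
      by (cases N) auto
    have "two_sided x (twist x c Y) N' D' v = 0"
      using Cons.prems N D' by (intro Cons.IH) auto
    then show ?thesis
      unfolding N D' using two_sided_root[OF x N(2)] by simp
  qed
qed

text \<open>
  The polynomial \<open>z\<^bsup>e0\<^esup> - \<Sum>e\<in>E. c e z\<^sup>e\<close> vanishes at all roots of the \<open>n\<close>-th higher relation. Hence the
  words \<open>x\<^bsup>N-e\<^esup> y\<^sup>n x\<^sup>e\<close> satisfy the same linear relation as the monomials do on the nodes.
\<close>
lemma exchange_relation:
  assumes p: "p \<noteq> 0" "\<And>n::nat. n > 0 \<Longrightarrow> p ^ n \<noteq> 1" and x: "endo x" and y: "endo y"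
    and serre: "fold (twist x) (map (serre_node p 1) [0..<3]) y = (\<lambda>_. 0)"
    and E: "E \<subseteq> {..N}" "e0 \<le> N" and c: "exchange_coeffs p n e0 E c"
  shows "(x ^^ (N - e0)) ((y ^^ n) ((x ^^ e0) v)) =
    (\<Sum>e\<in>E. c e *s (x ^^ (N - e)) ((y ^^ n) ((x ^^ e) v)))"
proof -
  define D where "D = monom 1 e0 - (\<Sum>e\<in>E. monom (c e) e)"
  have fin: "finite E" using E(1) finite_subset by blast
  have deg: "degree D \<le> N"
    unfolding D_def using E fin
    by (intro degree_diff_le degree_sum_le) (auto intro!: order.trans[OF degree_monom_le])
  have roots: "poly D z = 0" if "z \<in> set (map (serre_node p n) [0..<2 * n + 1])" for z
    using that c by (auto simp: D_def poly_monom poly_sum exchange_coeffs_def)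
  have "distinct (map (serre_node p n) [0..<2 * n + 1])"
    using power_inj_not_root_of_unity[OF p] p(1)
    by (auto simp: distinct_map inj_on_def serre_node_alt)
  from two_sided_vanishing[OF x this roots deg higher_q_Serre[OF p(1) x y serre]]
  have "0 = two_sided x (y ^^ n) N D v" by simp
  also have "\<dots> = (\<Sum>e\<le>N. (if e = e0 then (x ^^ (N - e)) ((y ^^ n) ((x ^^ e) v)) else 0)
      - (if e \<in> E then c e *s (x ^^ (N - e)) ((y ^^ n) ((x ^^ e) v)) else 0))"
    unfolding two_sided_def using fin
    by (intro sum.cong) (auto simp: D_def coeff_sum coeff_monom scale_left_diff_distrib
        if_distrib[of "\<lambda>t. _ - t"])
  also have "\<dots> = (x ^^ (N - e0)) ((y ^^ n) ((x ^^ e0) v))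
      - (\<Sum>e\<in>{..N} \<inter> E. c e *s (x ^^ (N - e)) ((y ^^ n) ((x ^^ e) v)))"
    using E(2) by (simp add: sum_subtractf sum.inter_restrict)
  also have "{..N} \<inter> E = E" using E(1) by auto
  finally show ?thesis by simp
qed

lemma exchange_relation_reflected:
  assumes p: "p \<noteq> 0" "\<And>n::nat. n > 0 \<Longrightarrow> p ^ n \<noteq> 1" and x: "endo x" and y: "endo y"
    and serre: "fold (twist x) (map (serre_node p 1) [0..<3]) y = (\<lambda>_. 0)"
    and E: "E \<subseteq> {..N}" "e0 \<le> N" and c: "exchange_coeffs p n e0 E c"
  shows "(x ^^ e0) ((y ^^ n) ((x ^^ (N - e0)) v)) =
    (\<Sum>e\<in>E. c e *s (x ^^ e) ((y ^^ n) ((x ^^ (N - e)) v)))"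
proof -
  have inj: "inj_on (\<lambda>e. N - e) E"
    using E(1) by (auto simp: inj_on_def subset_iff) (metis diff_diff_cancel)
  have "(\<lambda>e. N - e) ` E \<subseteq> {..N}" by auto
  from exchange_relation[OF p x y serre this _ exchange_coeffs_reflect[OF p(1) E c], of v]
  show ?thesis
    using E unfolding sum.reindex[OF inj] by (auto simp: subset_iff intro!: sum.cong)
qed

end

section \<open>A potential for rewriting words\<close>

lemma alternating_word_append:
  "alternating_word f g (xs @ ys) v =
    alternating_word f g xs (if even (length xs) then alternating_word f g ys v else alternating_word g f ys v)"
  by (induction xs arbitrary: f g) auto

lemma last_descent:
  fixes xs :: "nat list"
  assumes "\<not> sorted_wrt (<) xs"
  obtains pre r s rest where "xs = pre @ r # s # rest" "s \<le> r" "sorted_wrt (<) (s # rest)"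
proof -
  have "\<exists>pre r s rest. xs = pre @ r # s # rest \<and> s \<le> r \<and> sorted_wrt (<) (s # rest)"
    using assms
  proof (induction xs)
    case (Cons a xs)
    show ?case
    proof (cases "sorted_wrt (<) xs")
      case True
      with Cons.prems obtain s rest where xs: "xs = s # rest"
        by (cases xs) auto
      with True Cons.prems have "s \<le> a"
        by auto
      with xs True show ?thesis
        by (intro exI[of _ "[]"] exI[of _ a] exI[of _ s] exI[of _ rest]) auto
    next
      case False
      with Cons.IH obtain pre r s rest
        where "xs = pre @ r # s # rest" "s \<le> r" "sorted_wrt (<) (s # rest)" by blast
      then show ?thesis
        by (intro exI[of _ "a # pre"] exI[of _ r] exI[of _ s] exI[of _ rest]) auto
    qed
  qed simp
  then show thesis using that by blast
qed

text \<open>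
  This quantity makes the rewriting of words terminate. Rewriting \<open>x\<^sup>r y\<^sup>s x\<^sup>t\<close>, with \<open>r \<ge> s < t\<close>, moves
  \<open>r\<close> and \<open>t\<close> further apart at constant sum, which increases \<open>r\<^sup>2 + t\<^sup>2\<close>, except that it may
  interchange \<open>r = s\<close> and \<open>t\<close>. The linear term breaks this tie: it favours weight on the left, and its
  coefficients are small enough not to spoil the other cases.
\<close>
fun word_potential :: "nat \<Rightarrow> nat list \<Rightarrow> int" where
  "word_potential k [] = 0"
| "word_potential k (i # is) = int i ^ 2 - int k * int i + word_potential (Suc k) is"

lemma word_potential_append:
  "word_potential k (xs @ ys) = word_potential k xs + word_potential (k + length xs) ys"
  by (induction xs arbitrary: k) auto

lemma word_potential_bound: "word_potential k is \<le> int (sum_list is) ^ 2"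
proof (induction "is" arbitrary: k)
  case (Cons i "is")
  have "int i ^ 2 + int (sum_list is) ^ 2 \<le> int (sum_list (i # is)) ^ 2"
    by (simp add: power2_sum)
  with Cons[of "Suc k"] show ?case
    by simp (smt (verit) mult_nonneg_nonneg of_nat_0_le_iff)
qed simp

lemma word_potential_exchange:
  assumes "s \<le> r" "s < t" "e \<le> r + t" "e \<le> s \<or> r + t - e < s"
  shows "word_potential k (pre @ r # s # t # rest) <
    word_potential k (pre @ (r + t - e) # s # e # rest)"
proof -
  define m where "m = k + length pre"
  \<comment> \<open>Twice this product is the increase of the potential.\<close>
  have "0 < (int e - int t) * (int e - int r - 1)"
  proof (cases "e \<le> s")
    case True
    with assms show ?thesis by (intro mult_neg_neg) auto
  next
    case False
    with assms show ?thesis by (intro mult_pos_pos) auto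
  qed
  moreover have "int (r + t - e) = int r + int t - int e"
    using assms(3) by simp
  ultimately show ?thesis
    by (simp add: word_potential_append m_def[symmetric] algebra_simps power2_eq_square)
qed

section \<open>Commuting return maps and the reduction to increasing words\<close>

locale q_Serre_pair = endomorphisms scale
  for scale :: "'a::field \<Rightarrow> 'b::ab_group_add \<Rightarrow> 'b" (infixr \<open>*s\<close> 75) +
  fixes p :: 'a and L R :: "'b \<Rightarrow> 'b"
  assumes p_nonzero: "p \<noteq> 0"
    and p_not_root: "\<And>n::nat. n > 0 \<Longrightarrow> p ^ n \<noteq> 1"
    and endo_L: "endo L" and endo_R: "endo R"
    and serre_LR: "fold (twist L) (map (serre_node p 1) [0..<3]) R = (\<lambda>_. 0)"
    and serre_RL: "fold (twist R) (map (serre_node p 1) [0..<3]) L = (\<lambda>_. 0)"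
begin

text \<open>
  The only trace of the grading that is used here: \<open>L\<close> cannot lower a vector of degree \<open>0\<close> more often
  than \<open>R\<close> has raised it.
\<close>
definition lowest_vector :: "'b \<Rightarrow> bool" where
  "lowest_vector w \<longleftrightarrow> (\<forall>b t. t < b \<longrightarrow> (L ^^ b) ((R ^^ t) w) = 0)"

text \<open>
  The exponents in terms of which a word \<open>x\<^sup>r y\<^sup>n x\<^sup>t\<close> with \<open>r + t = N\<close> is expressed: those with \<open>t \<le> n\<close> and
  those with \<open>r < n\<close>.
\<close>
lemma outer_exponents:
  assumes "2 * n < N"
  shows "finite ({0..n} \<union> {N - n + 1..N})" "card ({0..n} \<union> {N - n + 1..N}) = 2 * n + 1"
    "{0..n} \<union> {N - n + 1..N} \<subseteq> {..N}"
proof -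
  have "card ({0..n} \<union> {N - n + 1..N}) = card {0..n} + card {N - n + 1..N}"
    using assms by (intro card_Un_disjoint) auto
  with assms show "card ({0..n} \<union> {N - n + 1..N}) = 2 * n + 1" by simp
qed (use assms in auto)

text \<open>
  Write \<open>G s b\<close> for \<open>L\<^bsup>N-b\<^esup> R\<^sup>s L\<^sup>b R\<^bsup>N-s\<^esup> w\<close>, so that the claim is \<open>G m b = G b m\<close>. Both \<open>b \<mapsto> G m b\<close> and
  \<open>b \<mapsto> G b m\<close> obey the exchange relations for \<open>n = m\<close>, the first one because of its left part
  \<open>L\<^bsup>N-b\<^esup> R\<^sup>m L\<^sup>b\<close> and the second one because of its right part \<open>R\<^sup>b L\<^sup>m R\<^bsup>N-b\<^esup>\<close>. So it suffices that they agree at \<open>2m+1\<close>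
  places. They do for \<open>b < m\<close> by induction and for \<open>b = m\<close> trivially, and for \<open>b > N - m\<close> both are \<open>0\<close>
  because \<open>w\<close> is a lowest vector.
\<close>
lemma four_letter_symmetry:
  assumes w: "lowest_vector w" and "2 * m < N" "b \<le> N"
  shows "(L ^^ (N - b)) ((R ^^ m) ((L ^^ b) ((R ^^ (N - m)) w))) =
         (L ^^ (N - m)) ((R ^^ b) ((L ^^ m) ((R ^^ (N - b)) w)))"
  using assms(2,3)
proof (induction m arbitrary: b rule: less_induct)
  case (less m b)
  let ?E = "{0..m} \<union> {N - m + 1..N}"
  let ?G = "\<lambda>s b. (L ^^ (N - b)) ((R ^^ s) ((L ^^ b) ((R ^^ (N - s)) w)))"
  note E = outer_exponents[OF less.prems(1)]
  obtain c where c: "exchange_coeffs p m b ?E c"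
    using exchange_coeffs_exist[OF p_nonzero p_not_root E(1,2)] by blast
  have agree: "?G m e = ?G e m" if e: "e \<in> ?E" for e
  proof -
    consider "e < m" | "e = m" | "N - m < e" "e \<le> N"
      using e by force
    then show ?thesis
    proof cases
      case 1
      then show ?thesis
        using less.IH[of e m] less.prems by simp
    next
      case 3
      then have "N - m < e" "N - e < m" using less.prems by auto
      then have "(L ^^ e) ((R ^^ (N - m)) w) = 0" "(L ^^ m) ((R ^^ (N - e)) w) = 0"
        using w unfolding lowest_vector_def by blast+
      then show ?thesis
        using endo_funpow[OF endo_L] endo_funpow[OF endo_R] by (simp add: endo_0)
    qed simp
  qed
  have "?G m b = (\<Sum>e\<in>?E. c e *s ?G m e)"
    by (rule exchange_relation[OF p_nonzero p_not_root endo_L endo_R serre_LR E(3) less.prems(2) c])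
  also have "\<dots> = (\<Sum>e\<in>?E. c e *s ?G e m)"
    using agree by (intro sum.cong) auto
  also have "\<dots> = (L ^^ (N - m)) (\<Sum>e\<in>?E. c e *s (R ^^ e) ((L ^^ m) ((R ^^ (N - e)) w)))"
    using endo_funpow[OF endo_L] by (simp add: endo_simps)
  also have "(\<Sum>e\<in>?E. c e *s (R ^^ e) ((L ^^ m) ((R ^^ (N - e)) w))) =
      (R ^^ b) ((L ^^ m) ((R ^^ (N - b)) w))"
    by (rule exchange_relation_reflected[OF p_nonzero p_not_root endo_R endo_L serre_RL E(3) less.prems(2) c,
          symmetric])
  finally show ?case .
qed

text \<open>
  The case \<open>N = i + j\<close>, \<open>m = i\<close>, \<open>b = j\<close> of the symmetry.
\<close>
lemma return_maps_commute:
  assumes w: "lowest_vector w"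
  shows "(L ^^ i) ((R ^^ i) ((L ^^ j) ((R ^^ j) w))) = (L ^^ j) ((R ^^ j) ((L ^^ i) ((R ^^ i) w)))"
proof (induction i j rule: linorder_wlog)
  case (le i j)
  show ?case
  proof (cases "i = j")
    case False
    with le have "2 * i < i + j" by simp
    from four_letter_symmetry[OF w this, of j] show ?thesis by simp
  qed simp
qed simp

definition increasing_words :: "'b \<Rightarrow> 'b set" where
  "increasing_words w =
    {alternating_word L R is w | is. even (length is) \<and> sorted_wrt (<) is}"

lemma endo_alternating_word: "endo f \<Longrightarrow> endo g \<Longrightarrow> endo (alternating_word f g is)"
  by (induction "is" arbitrary: f g) (auto intro!: endoI simp: endo_simps endo_funpow)

lemma outer_exchange:
  assumes xy: "x = L \<and> y = R \<or> x = R \<and> y = L" and rst: "s \<le> r" "s < t"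
  obtains c where "\<And>v. (x ^^ r) ((y ^^ s) ((x ^^ t) v)) =
    (\<Sum>e\<in>{0..s} \<union> {r + t - s + 1..r + t}. c e *s (x ^^ (r + t - e)) ((y ^^ s) ((x ^^ e) v)))"
proof -
  have "2 * s < r + t" using rst by simp
  note E = outer_exponents[OF this]
  have serre: "endo x" "endo y" "fold (twist x) (map (serre_node p 1) [0..<3]) y = (\<lambda>_. 0)"
    using xy endo_L endo_R serre_LR serre_RL by auto
  obtain c where "exchange_coeffs p s t ({0..s} \<union> {r + t - s + 1..r + t}) c"
    using exchange_coeffs_exist[OF p_nonzero p_not_root E(1,2)] by blast
  from exchange_relation[OF p_nonzero p_not_root serre E(3) _ this] show thesis
    by (intro that[of c]) simp
qed

text \<open>
  A word that is not increasing is rewritten at its last descent. If this descent is at the end of the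
  word, the last two exponents disappear. Otherwise the exchange relation keeps the length and the sum of
  the exponents and raises the potential, which the sum bounds. Exponents \<open>0\<close> are kept, so no two
  powers are ever merged and the positions in the word do not shift.
\<close>
lemma alternating_word_in_span_increasing:
  assumes w: "lowest_vector w" and eigen: "\<And>i. \<exists>c. (L ^^ i) ((R ^^ i) w) = c *s w"
    and "even (length is)"
  shows "alternating_word L R is w \<in> span (increasing_words w)"
  using assms(3)
proof (induction "is" rule: wf_induct[OF wf_measures[of
        "[length, \<lambda>is. nat (int (sum_list is) ^ 2 - word_potential 0 is)]"]])
  case (1 "is")
  note even = \<open>even (length is)\<close>
  have IH: "alternating_word L R js w \<in> span (increasing_words w)"
    if "length js < length is \<or> length js = length is \<and> sum_list js = sum_list is \<and>
        word_potential 0 is < word_potential 0 js" "even (length js)" for js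
    using 1(1) that word_potential_bound[of 0 js] by (auto simp: nat_mono_iff)
  show ?case
  proof (cases "sorted_wrt (<) is")
    case True
    with even show ?thesis
      by (intro span_base) (auto simp: increasing_words_def)
  next
    case False
    then obtain pre r s rest where is_eq: "is = pre @ r # s # rest" and sr: "s \<le> r"
      and sorted: "sorted_wrt (<) (s # rest)"
      by (rule last_descent)
    have pre_endo: "endo (alternating_word L R pre)"
      using endo_L endo_R by (rule endo_alternating_word)
    show ?thesis
    proof (cases rest)
      case Nil
      then have even_pre: "even (length pre)" using even is_eq by simp
      then have word: "alternating_word L R is w = alternating_word L R pre ((L ^^ r) ((R ^^ s) w))"
        using Nil by (simp add: is_eq alternating_word_append)
      show ?thesis
      proof (cases "s = r")
        case True
        with eigen[of r] obtain c where "(L ^^ r) ((R ^^ s) w) = c *s w" by auto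
        moreover have "alternating_word L R pre w \<in> span (increasing_words w)"
          using even_pre by (intro IH) (auto simp: is_eq)
        ultimately show ?thesis
          using pre_endo by (simp add: word endo_scale span_scale)
      next
        case False
        with sr w have "(L ^^ r) ((R ^^ s) w) = 0"
          by (simp add: lowest_vector_def)
        then show ?thesis
          using pre_endo by (simp add: word endo_0 span_zero)
      qed
    next
      case (Cons t rest')
      with sorted have st: "s < t" by simp
      define x y where "x = (if even (length pre) then L else R)"
        and "y = (if even (length pre) then R else L)"
      have word: "alternating_word L R (pre @ i # s # j # rest') w =
          alternating_word L R pre ((x ^^ i) ((y ^^ s) ((x ^^ j) (alternating_word y x rest' w))))" for i j
        by (simp add: alternating_word_append x_def y_def)
      have "x = L \<and> y = R \<or> x = R \<and> y = L"
        by (auto simp: x_def y_def)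
      from outer_exchange[OF this sr st] obtain c where c: "\<And>v. (x ^^ r) ((y ^^ s) ((x ^^ t) v)) =
          (\<Sum>e\<in>{0..s} \<union> {r + t - s + 1..r + t}. c e *s (x ^^ (r + t - e)) ((y ^^ s) ((x ^^ e) v)))"
        by blast
      have "alternating_word L R is w = (\<Sum>e\<in>{0..s} \<union> {r + t - s + 1..r + t}.
          c e *s alternating_word L R (pre @ (r + t - e) # s # e # rest') w)"
        using pre_endo by (simp only: is_eq Cons word c) (simp add: endo_simps)
      moreover have "alternating_word L R (pre @ (r + t - e) # s # e # rest') w \<in> span (increasing_words w)"
        if "e \<in> {0..s} \<union> {r + t - s + 1..r + t}" for e
      proof (rule IH)
        have "e \<le> r + t" "e \<le> s \<or> r + t - e < s"
          using that sr st by auto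
        with word_potential_exchange[OF sr st] show
          "length (pre @ (r + t - e) # s # e # rest') < length is \<or>
           length (pre @ (r + t - e) # s # e # rest') = length is \<and>
           sum_list (pre @ (r + t - e) # s # e # rest') = sum_list is \<and>
           word_potential 0 is < word_potential 0 (pre @ (r + t - e) # s # e # rest')"
          by (auto simp: is_eq Cons)
        show "even (length (pre @ (r + t - e) # s # e # rest'))"
          using even by (simp add: is_eq Cons)
      qed
      ultimately show ?thesis
        by (auto intro!: span_sum span_scale)
    qed
  qed
qed

end

section \<open>Common eigenvectors\<close>

locale fd_endomorphisms = endomorphisms scale + finite_dimensional_vector_space scale Basis
  for scale :: "'a::alg_closed_field \<Rightarrow> 'b::ab_group_add \<Rightarrow> 'b" (infixr \<open>*s\<close> 75)
    and Basis :: "'b set"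
begin

lemma annihilating_polynomial_exists:
  fixes f :: "nat \<Rightarrow> 'b"
  obtains P where "P \<noteq> 0" "(\<Sum>k\<le>degree P. coeff P k *s f k) = 0"
proof (cases "inj_on f {..dimension}")
  case False
  then obtain i j where ij: "i \<noteq> j" "f i = f j" by (auto simp: inj_on_def)
  define P where "P = monom (1::'a) i - monom 1 j"
  have coeff: "coeff P k = (if k = i then 1 else 0) - (if k = j then 1 else 0)" for k
    by (simp add: P_def coeff_monom)
  have "P \<noteq> 0" using ij(1) coeff[of i] by auto
  moreover have "i \<le> degree P" "j \<le> degree P"
    using ij(1) coeff[of i] coeff[of j] by (auto intro!: le_degree)
  then have "(\<Sum>k\<le>degree P. coeff P k *s f k) = f i - f j"
    by (simp add: coeff scale_left_diff_distrib sum_subtractf if_distrib[of "\<lambda>a. a *s _"] cong: if_cong)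
  ultimately show thesis using that ij(2) by simp
next
  case True
  have "\<not> independent (f ` {..dimension})"
  proof
    assume "independent (f ` {..dimension})"
    then have "card (f ` {..dimension}) \<le> dim (f ` {..dimension})"
      by (intro independent_card_le_dim) auto
    also have "\<dots> \<le> dimension" by (rule dim_subset_UNIV)
    finally show False by (simp add: card_image[OF True])
  qed
  then obtain u k where k: "k \<le> dimension" "u (f k) \<noteq> 0"
    and sum: "(\<Sum>v\<in>f ` {..dimension}. u v *s v) = 0"
    by (auto simp: dependent_finite)
  define P where "P = (\<Sum>k\<le>dimension. monom (u (f k)) k)"
  have coeff: "coeff P k = (if k \<le> dimension then u (f k) else 0)" for k
    by (simp add: P_def coeff_sum coeff_monom)
  have "P \<noteq> 0" using k coeff[of k] by auto
  have "degree P \<le> dimension" using coeff by (intro degree_le) auto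
  then have "(\<Sum>k\<le>degree P. coeff P k *s f k) = (\<Sum>k\<le>dimension. coeff P k *s f k)"
    by (intro sum.mono_neutral_left) (auto simp: coeff_eq_0)
  then have "(\<Sum>k\<le>degree P. coeff P k *s f k) = 0"
    using sum by (simp add: coeff sum.reindex[OF True])
  with \<open>P \<noteq> 0\<close> show thesis using that by blast
qed

text \<open>
  Take a nonzero polynomial \<open>P\<close> with \<open>P(T) u = 0\<close> and split off a linear factor, \<open>P = (z - r) Q\<close>. Either
  \<open>T u = r u\<close>, or \<open>u' = T u - r u\<close> is a nonzero vector with \<open>Q(T) u' = 0\<close> and \<open>Q\<close> has smaller degree.
\<close>
lemma eigenvector_exists:
  assumes T: "endo T" and W: "subspace W" "T ` W \<subseteq> W" "W \<noteq> {0}"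
  obtains u c where "u \<in> W" "u \<noteq> 0" "T u = c *s u"
proof -
  have *: "\<exists>u\<in>W. u \<noteq> 0 \<and> (\<exists>c. T u = c *s u)"
    if "P \<noteq> 0" "degree P = N" "(\<Sum>k\<le>N. coeff P k *s (T ^^ k) u) = 0" "u \<in> W" "u \<noteq> 0" for P N u
    using that
  proof (induction N arbitrary: P u)
    case 0
    then have "coeff P 0 = 0" by simp
    with 0 show ?case using leading_coeff_0_iff by fastforce
  next
    case (Suc N)
    then obtain r where "poly P r = 0"
      using alg_closed_imp_poly_has_root[of P] by auto
    then obtain Q where Q: "P = [:- r, 1:] * Q"
      by (auto simp: poly_eq_0_iff_dvd dvd_def)
    with Suc.prems have "Q \<noteq> 0" by auto
    with Suc.prems have degQ: "degree Q = N"
      unfolding Q by (subst (asm) degree_mult_eq) auto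
    define u' where "u' = T u - r *s u"
    have top: "coeff Q (Suc N) = 0" using degQ by (simp add: coeff_eq_0)
    have "0 = (\<Sum>k\<le>Suc N. coeff (pCons 0 Q) k *s (T ^^ k) u) - (\<Sum>k\<le>Suc N. (r * coeff Q k) *s (T ^^ k) u)"
      using Suc.prems(3) by (simp add: Q algebra_simps sum_subtractf scale_left_diff_distrib
        sum.distrib sum_negf flip: scale_minus_left)
    also have "\<dots> = (\<Sum>k\<le>N. coeff Q k *s (T ^^ k) u')"
      using endo_funpow[OF T]
      by (subst sum.atMost_Suc_shift) (simp add: top u'_def endo_simps funpow_swap1
          scale_right_diff_distrib sum_subtractf mult.commute)
    finally have sum: "(\<Sum>k\<le>N. coeff Q k *s (T ^^ k) u') = 0" by simp
    have "u' \<in> W"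
      using W Suc.prems(4) by (auto simp: u'_def intro!: subspace_diff subspace_scale)
    with Suc.IH[OF \<open>Q \<noteq> 0\<close> degQ sum] Suc.prems(4,5) show ?case
      by (cases "u' = 0") (auto simp: u'_def)
  qed
  obtain u where u: "u \<in> W" "u \<noteq> 0"
    using W(1,3) subspace_0 by blast
  obtain P where "P \<noteq> 0" "(\<Sum>k\<le>degree P. coeff P k *s (T ^^ k) u) = 0"
    by (rule annihilating_polynomial_exists)
  from *[OF this(1) refl this(2) u] show thesis using that by blast
qed

text \<open>
  In a nonzero invariant subspace of least dimension every \<open>T i\<close> is a scalar, since its eigenspaces there
  are again invariant.
\<close>
lemma common_eigenvector_exists:
  fixes T :: "'i \<Rightarrow> 'b \<Rightarrow> 'b"
  assumes T: "\<And>i. endo (T i)" and W: "subspace W" "W \<noteq> {0}" "\<And>i. T i ` W \<subseteq> W"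
    and comm: "\<And>i j u. u \<in> W \<Longrightarrow> T i (T j u) = T j (T i u)"
  obtains u where "u \<in> W" "u \<noteq> 0" "\<And>i. \<exists>c. T i u = c *s u"
proof -
  define inv where "inv X \<longleftrightarrow> subspace X \<and> X \<noteq> {0} \<and> X \<subseteq> W \<and> (\<forall>i. T i ` X \<subseteq> X)" for X
  have "inv W" using W by (simp add: inv_def)
  then obtain X where X: "inv X" and min: "\<And>Y. inv Y \<Longrightarrow> dim X \<le> dim Y"
    using ex_has_least_nat[of inv W dim] by blast
  have scalar: "\<exists>c. \<forall>u\<in>X. T i u = c *s u" for i
  proof -
    obtain u c where u: "u \<in> X" "u \<noteq> 0" "T i u = c *s u"
      using eigenvector_exists[OF T, of X i] X by (auto simp: inv_def)
    define Y where "Y = {u \<in> X. T i u = c *s u}"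
    have "subspace Y"
      using X T[of i] unfolding inv_def Y_def subspace_def
      by (auto simp: endo_simps scale_right_distrib scale_left_commute)
    moreover have "T j ` Y \<subseteq> Y" for j
    proof (rule image_subsetI)
      fix y assume "y \<in> Y"
      then have y: "y \<in> X" "y \<in> W" "T i y = c *s y"
        using X by (auto simp: Y_def inv_def)
      then have "T i (T j y) = c *s T j y"
        using comm[of y i j] T[of j] by (simp add: endo_scale)
      with y X show "T j y \<in> Y" by (auto simp: Y_def inv_def)
    qed
    ultimately have "inv Y"
      using X u by (auto simp: inv_def Y_def)
    then have "Y = X"
      using X min by (intro subspace_dim_equal) (auto simp: inv_def Y_def)
    then show ?thesis by (auto simp: Y_def)
  qed
  obtain u where u: "u \<in> X" "u \<noteq> 0"
    using X subspace_0 unfolding inv_def by blast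
  then have "u \<in> W" using X by (auto simp: inv_def)
  moreover have "\<exists>c. T i u = c *s u" for i
    using scalar[of i] u(1) by blast
  ultimately show thesis using that u(2) by blast
qed

end

section \<open>Graded q-Serre pairs\<close>

text \<open>
  The grading is indexed by all integers, with zero components outside \<open>0, \<dots>, d\<close>. Then \<open>L\<close> and \<open>R\<close>
  shift degrees without exceptions at the two ends, and reversing the grading exchanges their roles. The
  \<open>E n\<close> are the projections to the components.
\<close>
locale graded_q_Serre_pair = q_Serre_pair scale p L R + fd_endomorphisms scale Basis
  for scale :: "'a::alg_closed_field \<Rightarrow> 'b::ab_group_add \<Rightarrow> 'b" (infixr \<open>*s\<close> 75)
    and p :: 'a and L R :: "'b \<Rightarrow> 'b" and Basis :: "'b set" +
  fixes d :: nat and G :: "int \<Rightarrow> 'b set" and E :: "int \<Rightarrow> 'b \<Rightarrow> 'b"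
  assumes subspace_G: "\<And>n. subspace (G n)"
    and G_outside: "\<And>n. n < 0 \<or> int d < n \<Longrightarrow> G n = {0}"
    and L_shift: "\<And>n u. u \<in> G n \<Longrightarrow> L u \<in> G (n - 1)"
    and R_shift: "\<And>n u. u \<in> G n \<Longrightarrow> R u \<in> G (n + 1)"
    and endo_E: "\<And>n. endo (E n)"
    and E_G: "\<And>m n u. u \<in> G m \<Longrightarrow> E n u = (if m = n then u else 0)"
begin

lemma funpow_L_shift: "u \<in> G n \<Longrightarrow> (L ^^ k) u \<in> G (n - int k)"
  by (induction k) (auto dest: L_shift simp: algebra_simps)

lemma funpow_R_shift: "u \<in> G n \<Longrightarrow> (R ^^ k) u \<in> G (n + int k)"
  by (induction k) (auto dest: R_shift simp: algebra_simps)

lemma return_map_G0: "u \<in> G 0 \<Longrightarrow> (L ^^ i) ((R ^^ i) u) \<in> G 0"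
  using funpow_L_shift[OF funpow_R_shift, of u 0 i i] by simp

lemma lowest_vector_G0:
  assumes "w \<in> G 0"
  shows "lowest_vector w"
  unfolding lowest_vector_def
proof (intro allI impI)
  fix b t :: nat assume "t < b"
  then show "(L ^^ b) ((R ^^ t) w) = 0"
    using funpow_L_shift[OF funpow_R_shift[OF assms], of b t] G_outside[of "int t - int b"] by simp
qed

lemma alternating_word_homogeneous:
  assumes "w \<in> G 0" and "f = L \<and> g = R \<or> f = R \<and> g = L"
  shows "\<exists>m. alternating_word f g is w \<in> G m"
  using assms(2)
proof (induction "is" arbitrary: f g)
  case (Cons i "is")
  then obtain m where "alternating_word g f is w \<in> G m" by blast
  from funpow_L_shift[OF this, of i] funpow_R_shift[OF this, of i] Cons.prems show ?case
    by auto
qed (use assms(1) in auto)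

text \<open>
  Each pair \<open>L\<^sup>i R\<^sup>j\<close> with \<open>i < j\<close> raises the degree by \<open>j - i > 0\<close>.
\<close>
lemma increasing_word_degree:
  assumes "w \<in> G 0" "even (length is)" "sorted_wrt (<) is"
  shows "\<exists>m\<ge>0. alternating_word L R is w \<in> G m \<and> (is \<noteq> [] \<longrightarrow> m > 0)"
  using assms(2,3)
proof (induction "is" rule: induct_list012)
  case (3 i j "is")
  then obtain m where m: "m \<ge> 0" "alternating_word L R is w \<in> G m" by auto
  from funpow_L_shift[OF funpow_R_shift[OF m(2)], of i j]
  have "alternating_word L R (i # j # is) w \<in> G (m + int j - int i)" by simp
  moreover have "i < j" using 3 by simp
  ultimately show ?case
    using m(1) by (intro exI[of _ "m + int j - int i"]) auto
qed (use assms(1) in auto)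

lemma long_increasing_word_zero:
  assumes "w \<in> G 0" "even (length is)" "sorted_wrt (<) is" "\<not> set is \<subseteq> {0..d}"
  shows "alternating_word L R is w = 0"
proof -
  obtain js i where js: "is = js @ [i]"
    using assms(4) by (cases "is" rule: rev_cases) auto
  have "d < i"
    using assms(3,4) by (force simp: js sorted_wrt_append)
  with funpow_R_shift[OF assms(1), of i] G_outside[of "int i"] have "(R ^^ i) w = 0" by simp
  moreover have "odd (length js)" using assms(2) js by simp
  ultimately show ?thesis
    using endo_alternating_word[OF endo_L endo_R]
    by (simp add: js alternating_word_append endo_0)
qed

text \<open>
  The claim holds for a common eigenvector \<open>w\<close> of the maps \<open>L\<^sup>i R\<^sup>i\<close> in \<open>G 0\<close>. Projecting the resulting
  spanning set to degree \<open>0\<close> leaves only \<open>w\<close>, so that \<open>v\<close> is a multiple of \<open>w\<close>.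
\<close>
theorem span_bounded_increasing_words:
  assumes irreducible: "\<And>W. \<lbrakk>subspace W; W \<noteq> {0}; L ` W \<subseteq> W; R ` W \<subseteq> W; \<And>n. E n ` W \<subseteq> W\<rbrakk> \<Longrightarrow> W = UNIV"
    and v: "v \<in> G 0" "v \<noteq> 0"
  shows "span {alternating_word L R is v | is. even (length is) \<and> sorted_wrt (<) is \<and> set is \<subseteq> {0..d}} = UNIV"
    (is "span ?B = UNIV")
proof -
  have "G 0 \<noteq> {0}" using v by auto
  moreover have "endo (\<lambda>u. (L ^^ i) ((R ^^ i) u))" for i
    using endo_funpow[OF endo_L] endo_funpow[OF endo_R] by (intro endoI) (auto simp: endo_simps)
  ultimately obtain w where w: "w \<in> G 0" "w \<noteq> 0"
      and eigen: "\<And>i. \<exists>c. (L ^^ i) ((R ^^ i) w) = c *s w"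
    using return_map_G0 subspace_G return_maps_commute[OF lowest_vector_G0]
    by (elim common_eigenvector_exists[of "\<lambda>i u. (L ^^ i) ((R ^^ i) u)" "G 0", rotated -1]) auto
  define W where "W = span {alternating_word L R is w | is. even (length is)}"
  have word_W: "alternating_word L R is w \<in> W" if "even (length is)" for "is"
    unfolding W_def using that by (intro span_base) auto
  have stable: "f ` W \<subseteq> W" if f: "endo f"
    and "\<And>is. even (length is) \<Longrightarrow> f (alternating_word L R is w) \<in> W" for f
  proof -
    have "f ` W = span (f ` {alternating_word L R is w | is. even (length is)})"
      unfolding W_def using f by (simp add: module_hom.span_image linear_iff_module_hom)
    also have "\<dots> \<subseteq> W"
      using that by (intro span_minimal) (auto simp: W_def)
    finally show ?thesis .
  qed
  have "W = UNIV"
  proof (rule irreducible)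
    show "subspace W" by (simp add: W_def)
    show "W \<noteq> {0}" using word_W[of "[]"] w(2) by auto
    show "L ` W \<subseteq> W"
    proof (rule stable[OF endo_L])
      fix "is" :: "nat list" assume "even (length is)"
      \<comment> \<open>\<open>L w\<close> is the word with exponents \<open>1, 0\<close>; in all other cases \<open>L\<close> adds one to the first exponent.\<close>
      then show "L (alternating_word L R is w) \<in> W"
        using word_W[of "case is of [] \<Rightarrow> [1, 0] | i # js \<Rightarrow> Suc i # js"] by (cases "is") auto
    qed
    show "R ` W \<subseteq> W"
    proof (rule stable[OF endo_R])
      fix "is" :: "nat list" assume "even (length is)"
      \<comment> \<open>A word begins with a power of \<open>L\<close>, so that \<open>R\<close> is prefixed as \<open>L\<^sup>0 R\<^sup>1\<close>.\<close>
      then show "R (alternating_word L R is w) \<in> W"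
        using word_W[of "0 # 1 # is"] by simp
    qed
    show "E n ` W \<subseteq> W" for n
    proof (rule stable[OF endo_E])
      fix "is" :: "nat list" assume "even (length is)"
      moreover obtain m where "alternating_word L R is w \<in> G m"
        using alternating_word_homogeneous[OF w(1)] by blast
      ultimately show "E n (alternating_word L R is w) \<in> W"
        using word_W by (auto simp: E_G W_def span_zero)
    qed
  qed
  moreover have "W \<subseteq> span (increasing_words w)"
    unfolding W_def using alternating_word_in_span_increasing[OF lowest_vector_G0[OF w(1)] eigen]
    by (intro span_minimal) auto
  ultimately have inc: "span (increasing_words w) = UNIV" by blast
  have "span (increasing_words w) \<subseteq> {u. E 0 u \<in> span {w}}"
  proof (rule span_minimal)
    show "subspace {u. E 0 u \<in> span {w}}"
      using endo_E[of 0] by (auto simp: subspace_def endo_simps span_zero span_add span_scale)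
    show "increasing_words w \<subseteq> {u. E 0 u \<in> span {w}}"
    proof safe
      fix u assume "u \<in> increasing_words w"
      then obtain "is" where is_u: "u = alternating_word L R is w"
          "even (length is)" "sorted_wrt (<) is"
        by (auto simp: increasing_words_def)
      from increasing_word_degree[OF w(1) is_u(2,3)]
      obtain m where "u \<in> G m" "is \<noteq> [] \<longrightarrow> m > 0" using is_u(1) by blast
      then show "E 0 u \<in> span {w}"
        using w(1) is_u(1) by (cases "is = []") (auto simp: E_G span_zero span_base)
    qed
  qed
  then have "E 0 v \<in> span {w}" using inc by auto
  then obtain c where c: "v = c *s w"
    using v(1) by (auto simp: E_G span_singleton)
  with v(2) have "c \<noteq> 0" by auto
  then have w_eq: "w = inverse c *s v" by (simp add: c)
  have "increasing_words w \<subseteq> span ?B"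
  proof
    fix u assume "u \<in> increasing_words w"
    then obtain "is" where is_u: "u = alternating_word L R is w"
        "even (length is)" "sorted_wrt (<) is"
      by (auto simp: increasing_words_def)
    show "u \<in> span ?B"
    proof (cases "set is \<subseteq> {0..d}")
      case True
      then have "alternating_word L R is v \<in> span ?B"
        using is_u by (intro span_base) auto
      then show ?thesis
        using endo_alternating_word[OF endo_L endo_R]
        by (simp add: is_u(1) w_eq endo_scale span_scale)
    next
      case False
      with long_increasing_word_zero[OF w(1) is_u(2,3)] show ?thesis
        by (simp add: is_u(1) span_zero)
    qed
  qed
  then have "span (increasing_words w) \<subseteq> span ?B"
    by (intro span_minimal) auto
  with inc show ?thesis by blast
qed

end

section \<open>The raising and lowering maps of a split decomposition\<close>

context endomorphisms
begin

text \<open>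
  Substitute \<open>A = R + t\<close> and \<open>B = L + ts\<close> in the relation for \<open>A, B\<close> on a vector \<open>u\<close> of degree \<open>n\<close> and
  compare components of degree \<open>n + 2\<close>. They consist of the relation for \<open>R, L\<close> and of a multiple of
  \<open>R\<^sup>2 u\<close>. Because \<open>t\<close> and \<open>ts\<close> are geometric with inverse ratios, the factor of \<open>R\<^sup>2 u\<close> is a multiple of
  \<open>1 + q\<^sup>2 + q\<^sup>4 - [3] q\<^sup>2 = 0\<close>. The relation with \<open>L, R\<close> exchanged is the same statement for the
  reversed grading.
\<close>
lemma raising_lowering_q_Serre:
  fixes t ts :: "int \<Rightarrow> 'a" and G :: "int \<Rightarrow> 'b set" and E :: "int \<Rightarrow> 'b \<Rightarrow> 'b"
  assumes q: "q \<noteq> 0" "q ^ 2 \<noteq> 1"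
    and endo: "endo A" "endo B" "endo R" "endo L" "\<And>n. endo (E n)"
    and E: "\<And>m n u. u \<in> G m \<Longrightarrow> E n u = (if m = n then u else 0)"
    and G: "span (\<Union>n. G n) = UNIV"
    and R: "\<And>n u. u \<in> G n \<Longrightarrow> R u \<in> G (n + 1)"
    and L: "\<And>n u. u \<in> G n \<Longrightarrow> L u \<in> G (n - 1)"
    and A: "\<And>n u. u \<in> G n \<Longrightarrow> A u = R u + t n *s u"
    and B: "\<And>n u. u \<in> G n \<Longrightarrow> B u = L u + ts n *s u"
    and t: "\<And>n. t (n + 1) = q ^ 2 * t n"
    and ts: "\<And>n. ts n = q ^ 2 * ts (n + 1)"
    and serre: "q_Serre_relation scale q A B"
  shows "q_Serre_relation scale q R L"
proof -
  have cube: "(f ^^ 3) u = f (f (f u))" and square: "(f ^^ 2) u = f (f u)" for f :: "'b \<Rightarrow> 'b" and u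
    by (simp_all add: eval_nat_numeral)
  define k where "k = q_number q 3"
  define S where "S f g u = f (f (f (g u))) - k *s f (f (g (f u))) + k *s f (g (f (f u))) - g (f (f (f u)))"
    for f g :: "'b \<Rightarrow> 'b" and u
  have S_zero: "S R L u = 0" if u: "u \<in> G n" for u n
  proof -
    define a b where "a = t n" and "b = ts (n + 2)"
    have t': "t n = a" "t (n + 1) = q ^ 2 * a" "t (n + 2) = q ^ 4 * a"
      using t[of n] t[of "n + 1"] by (simp_all add: a_def power2_eq_square power4_eq_xxxx add.assoc)
    have ts': "ts n = q ^ 4 * b" "ts (n + 1) = q ^ 2 * b" "ts (n + 2) = b"
      using ts[of n] ts[of "n + 1"] by (simp_all add: b_def power2_eq_square power4_eq_xxxx add.assoc)
    have R': "R x \<in> G j" if "x \<in> G i" "j = i + 1" for x i j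
      using R that by simp
    have L': "L x \<in> G j" if "x \<in> G i" "j = i - 1" for x i j
      using L that by simp
    have r1: "R u \<in> G (n + 1)" by (rule R'[OF u]) simp
    have r2: "R (R u) \<in> G (n + 2)" by (rule R'[OF r1]) simp
    have r3: "R (R (R u)) \<in> G (n + 3)" by (rule R'[OF r2]) simp
    have l1: "L u \<in> G (n - 1)" by (rule L'[OF u]) simp
    have l2: "R (L u) \<in> G n" by (rule R'[OF l1]) simp
    have l3: "R (R (L u)) \<in> G (n + 1)" by (rule R'[OF l2]) simp
    have l4: "R (R (R (L u))) \<in> G (n + 2)" by (rule R'[OF l3]) simp
    have rl1: "L (R u) \<in> G n" by (rule L'[OF r1]) simp
    have rl2: "R (L (R u)) \<in> G (n + 1)" by (rule R'[OF rl1]) simp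
    have rl3: "R (R (L (R u))) \<in> G (n + 2)" by (rule R'[OF rl2]) simp
    have rrl1: "L (R (R u)) \<in> G (n + 1)" by (rule L'[OF r2]) simp
    have rrl2: "R (L (R (R u))) \<in> G (n + 2)" by (rule R'[OF rrl1]) simp
    have rrrl1: "L (R (R (R u))) \<in> G (n + 2)" by (rule L'[OF r3]) simp
    note mem = u r1 r2 r3 l1 l2 l3 l4 rl1 rl2 rl3 rrl1 rrl2 rrrl1
    note step = mem[THEN A] mem[THEN B]
    note lin = endo[THEN endo_add] endo[THEN endo_scale] endo[THEN endo_diff]
    note proj = mem[THEN E]
    have 1: "E (n + 2) (A (A (A (B u)))) = R (R (R (L u))) + ((t n + t (n + 1) + t (n + 2)) * ts n) *s R (R u)"
      by (simp add: step lin proj scale_left_distrib algebra_simps)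
    have 2: "E (n + 2) (A (A (B (A u)))) = R (R (L (R u))) + (t n * ts n + (t (n + 1) + t (n + 2)) * ts (n + 1)) *s R (R u)"
      by (simp add: step lin proj scale_left_distrib algebra_simps)
    have 3: "E (n + 2) (A (B (A (A u)))) = R (L (R (R u))) + ((t n + t (n + 1)) * ts (n + 1) + t (n + 2) * ts (n + 2)) *s R (R u)"
      by (simp add: step lin proj scale_left_distrib algebra_simps)
    have 4: "E (n + 2) (B (A (A (A u)))) = L (R (R (R u))) + ((t n + t (n + 1) + t (n + 2)) * ts (n + 2)) *s R (R u)"
      by (simp add: step lin proj scale_left_distrib algebra_simps)
    have "S A B u = 0"
      using serre by (simp add: q_Serre_relation_def S_def k_def cube square)
    then have "E (n + 2) (S A B u) = 0" using endo(5) by (simp add: endo_0)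
    then have "0 = S R L u + ((t n + t (n + 1) + t (n + 2)) * ts n
        - k * (t n * ts n + (t (n + 1) + t (n + 2)) * ts (n + 1))
        + k * ((t n + t (n + 1)) * ts (n + 1) + t (n + 2) * ts (n + 2))
        - (t n + t (n + 1) + t (n + 2)) * ts (n + 2)) *s R (R u)" (is "_ = _ + ?c *s _")
      unfolding S_def lin 1 2 3 4
      by (simp add: scale_left_distrib scale_left_diff_distrib scale_right_distrib algebra_simps)
    moreover have "?c = 0"
    proof -
      have "?c = a * b * ((1 + q ^ 2 + q ^ 4) * (q ^ 4 - 1) - (k * q ^ 2) * (q ^ 4 - 1))"
        unfolding t' ts' by algebra
      also have "k * q ^ 2 = 1 + q ^ 2 + q ^ 4"
        using q by (simp add: k_def q_number_3 field_simps)
      finally show ?thesis by simp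
    qed
    ultimately show ?thesis by simp
  qed
  have "endo (S R L)"
    using endo by (intro endoI) (auto simp: S_def endo_simps algebra_simps scale_left_commute)
  then have "subspace {u. S R L u = 0}"
    by (auto simp: subspace_def endo_simps)
  then have "span (\<Union>n. G n) \<subseteq> {u. S R L u = 0}"
    using S_zero by (intro span_minimal) auto
  then have "S R L u = 0" for u
    using G by auto
  then show ?thesis
    by (simp add: q_Serre_relation_def S_def k_def cube square)
qed

end

theorem theorem1p7:
  fixes scale :: "'k::{alg_closed_field, field_char_0} \<Rightarrow> 'v::ab_group_add \<Rightarrow> 'v"
    and Basis :: "'v set"
    and q a as :: 'k
    and A As R L :: "'v \<Rightarrow> 'v"
    and d :: nat
    and \<theta> \<theta>s :: "nat \<Rightarrow> 'k"
    and U :: "nat \<Rightarrow> 'v set"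
    and v :: 'v
  assumes "finite_dimensional_vector_space scale Basis"
    and "vector_space.dim scale (UNIV :: 'v set) > 0"
    and "q \<noteq> 0"
    and "\<And>n::nat. n > 0 \<Longrightarrow> q ^ n \<noteq> 1"
    and "tridiagonal_pair_of_diameter scale A As d"
    and "q_Serre_relation scale q A As"
    and "q_Serre_relation scale q As A"
    and "\<And>i. i \<le> d \<Longrightarrow> \<theta> i = a * q powi (2 * int i - int d)"
    and "\<And>i. i \<le> d \<Longrightarrow> \<theta>s i = as * q powi (int d - 2 * int i)"
    and "standard_eigenvalue_ordering scale A As d \<theta>"
    and "standard_eigenvalue_ordering scale As A d \<theta>s"
    and "split_decomposition scale A As d \<theta> \<theta>s U"
    and "R = raising_map scale A d \<theta> U"
    and "L = lowering_map scale As d \<theta>s U"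
    and "v \<in> U 0"
    and "v \<noteq> 0"
  shows "module.span scale
           {alternating_word L R is v | is.
              even (length is) \<and> sorted_wrt (<) is \<and> set is \<subseteq> {0..d}} = UNIV"
proof -
  interpret fd_endomorphisms scale Basis
    using assms(1) by (simp add: fd_endomorphisms_def endomorphisms_def finite_dimensional_vector_space_def)
  note vs = vector_space_axioms
  note q = assms(3)
  note dec = assms(12)[unfolded split_decomposition_def]
  have pair: "endo A" "endo As"
    and irreducible: "\<And>W. subspace W \<Longrightarrow> A ` W \<subseteq> W \<Longrightarrow> As ` W \<subseteq> W \<Longrightarrow> W \<noteq> {0} \<Longrightarrow> W = UNIV"
    using assms(5) unfolding tridiagonal_pair_of_diameter_def tridiagonal_pair_def by blast+
  have U: "direct_sum_decomposition scale d U"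
    using dec by blast
  have U_sub: "subspace (U i)" if "i \<le> d" for i
    using U that by (simp add: direct_sum_decomposition_def)
  define F where "F h = projection scale d U h" for h
  have F: "is_projection scale d U h (F h)" if "h \<le> d" for h
    unfolding F_def using is_projection_projection[OF vs U that] .
  have endo_F: "endo (F h)" if "h \<le> d" for h
    using F[OF that] by (simp add: is_projection_def)
  have F_U: "F h u = (if h = i then u else 0)" if "u \<in> U i" "i \<le> d" "h \<le> d" for u h i
    using F[OF that(3)] that by (auto simp: is_projection_def)
  have R_eq: "R u = A u - (\<Sum>h\<le>d. scale (\<theta> h) (F h u))" and L_eq: "L u = As u - (\<Sum>h\<le>d. scale (\<theta>s h) (F h u))" for u
    by (simp_all add: assms(13,14) raising_map_def lowering_map_def F_def)
  have diag: "(\<Sum>h\<le>d. scale (c h) (F h u)) = scale (c i) (u)" if "u \<in> U i" "i \<le> d" for c u i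
  proof -
    have "(\<Sum>h\<le>d. scale (c h) (F h u)) = (\<Sum>h\<le>d. if h = i then scale (c i) (u) else 0)"
      using that by (intro sum.cong) (auto simp: F_U)
    then show ?thesis using that by simp
  qed
  have endo_sum_F: "endo (\<lambda>u. \<Sum>h\<le>d. scale (c h) (F h u))" for c
    using endo_F by (intro endoI) (auto simp: endo_simps scale_right_distrib sum.distrib scale_sum_right
        mult.commute intro!: sum.cong)
  have R_fun: "R = (\<lambda>u. A u - (\<Sum>h\<le>d. scale (\<theta> h) (F h u)))"
    and L_fun: "L = (\<lambda>u. As u - (\<Sum>h\<le>d. scale (\<theta>s h) (F h u)))"
    by (auto simp: R_eq L_eq)
  have endo_R: "endo R" and endo_L: "endo L"
    unfolding R_fun L_fun using endo_minus pair endo_sum_F by blast+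

  \<comment> \<open>The components and the eigenvalues, continued to all integers.\<close>
  define G where "G n = (if 0 \<le> n \<and> n \<le> int d then U (nat n) else {0})" for n
  define E where "E n = (if 0 \<le> n \<and> n \<le> int d then F (nat n) else (\<lambda>_. 0))" for n
  define t where "t n = a * q powi (2 * n - int d)" for n
  define ts where "ts n = as * q powi (int d - 2 * n)" for n
  have G_U: "G (int i) = U i" if "i \<le> d" for i
    using that by (simp add: G_def)
  have G_cases: thesis if "u \<in> G n" "\<And>i. i \<le> d \<Longrightarrow> n = int i \<Longrightarrow> u \<in> U i \<Longrightarrow> thesis" "u = 0 \<Longrightarrow> thesis"
    for u n thesis
    using that(1) that(2)[of "nat n"] that(3) by (auto simp: G_def split: if_splits)
  have sub_G: "subspace (G n)" for n
    using U_sub by (auto simp: G_def)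
  have endo_E: "endo (E n)" for n
  proof -
    have "endo (\<lambda>_. 0)" by (intro endoI) auto
    then show ?thesis using endo_F[of "nat n"] by (simp add: E_def nat_le_iff)
  qed
  have E_G: "E n u = (if m = n then u else 0)" if "u \<in> G m" for m n u
    using that(1)
  proof (rule G_cases)
    fix i assume "i \<le> d" "m = int i" "u \<in> U i"
    then show ?thesis by (auto simp: E_def F_U)
  next
    assume "u = 0"
    then show ?thesis using endo_E[of n] by (simp add: endo_0)
  qed
  have span_G: "span (\<Union>n. G n) = UNIV"
  proof -
    have "u \<in> span (\<Union>n. G n)" for u
    proof -
      obtain c where c: "\<And>i. i \<le> d \<Longrightarrow> c i \<in> U i" "u = (\<Sum>i\<le>d. c i)"
        using direct_sum_components[OF U] by metis
      have "c i \<in> span (\<Union>n. G n)" if "i \<le> d" for i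
        using c(1)[OF that] G_U[OF that] by (intro span_base) blast
      then show ?thesis unfolding c(2) by (intro span_sum) auto
    qed
    then show ?thesis by auto
  qed
  have A_G: "A u = R u + scale (t n) (u)" if "u \<in> G n" for n u
    using that
  proof (rule G_cases)
    fix i assume "i \<le> d" "n = int i" "u \<in> U i"
    then show ?thesis using diag[of u i \<theta>] assms(8)[of i] by (simp add: R_eq t_def)
  qed (use pair endo_R in \<open>simp add: endo_0\<close>)
  have As_G: "As u = L u + scale (ts n) (u)" if "u \<in> G n" for n u
    using that
  proof (rule G_cases)
    fix i assume "i \<le> d" "n = int i" "u \<in> U i"
    then show ?thesis using diag[of u i \<theta>s] assms(9)[of i] by (simp add: L_eq ts_def)
  qed (use pair endo_L in \<open>simp add: endo_0\<close>)
  have R_G: "R u \<in> G (n + 1)" if "u \<in> G n" for n u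
    using that
  proof (rule G_cases)
    fix i assume i: "i \<le> d" "n = int i" "u \<in> U i"
    have R_u: "R u = A u - scale (\<theta> i) (u)"
      using diag[of u i \<theta>] i by (simp add: R_eq)
    show ?thesis
    proof (cases "i = d")
      case True
      then have "R u \<in> (\<lambda>u. A u - scale (\<theta> d) u) ` U d" using i R_u by auto
      then have "R u = 0" using dec by simp
      then show ?thesis using sub_G subspace_0 by simp
    next
      case False
      then have "(\<lambda>u. A u - scale (\<theta> i) u) ` U i \<subseteq> U (i + 1)" using dec i by simp
      then have "R u \<in> U (i + 1)" using i R_u by auto
      then show ?thesis using G_U[of "i + 1"] i False by (simp add: add.commute)
    qed
  qed (use endo_R sub_G subspace_0 in \<open>simp add: endo_0\<close>)
  have L_G: "L u \<in> G (n - 1)" if "u \<in> G n" for n u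
    using that
  proof (rule G_cases)
    fix i assume i: "i \<le> d" "n = int i" "u \<in> U i"
    have L_u: "L u = As u - scale (\<theta>s i) (u)"
      using diag[of u i \<theta>s] i by (simp add: L_eq)
    show ?thesis
    proof (cases "i = 0")
      case True
      then have "L u \<in> (\<lambda>u. As u - scale (\<theta>s 0) u) ` U 0" using i L_u by auto
      then have "L u = 0" using dec by simp
      then show ?thesis using sub_G subspace_0 by simp
    next
      case False
      then have "(\<lambda>u. As u - scale (\<theta>s i) u) ` U i \<subseteq> U (i - 1)" using dec i by simp
      then have "L u \<in> U (i - 1)" using i L_u by auto
      then show ?thesis using G_U[of "i - 1"] i False by (simp add: of_nat_diff)
    qed
  qed (use endo_L sub_G subspace_0 in \<open>simp add: endo_0\<close>)

  have q2: "q ^ 2 \<noteq> 1" using assms(4)[of 2] by simp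
  have t_step: "t (n + 1) = q ^ 2 * t n" and ts_step: "ts n = q ^ 2 * ts (n + 1)" for n
    using q power_int_add[of q 2 "2 * n - int d"] power_int_add[of q 2 "int d - 2 * (n + 1)"]
    by (simp_all add: t_def ts_def algebra_simps)
  have serre_RL: "q_Serre_relation scale q R L"
    by (rule raising_lowering_q_Serre[where G = G and E = E and t = t and ts = ts,
          OF q q2 pair endo_R endo_L endo_E E_G span_G R_G L_G A_G As_G t_step ts_step assms(6)])
  \<comment> \<open>Reversing the grading turns \<open>As\<close> into the raising and \<open>A\<close> into the lowering member.\<close>
  have serre_LR: "q_Serre_relation scale q L R"
  proof (rule raising_lowering_q_Serre[where G = "\<lambda>n. G (- n)" and E = "\<lambda>n. E (- n)"
        and t = "\<lambda>n. ts (- n)" and ts = "\<lambda>n. t (- n)",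
        OF q q2 pair(2,1) endo_L endo_R endo_E _ _ _ _ As_G A_G _ _ assms(7)])
    show "E (- n) u = (if m = n then u else 0)" if "u \<in> G (- m)" for m n u
      using E_G[OF that, of "- n"] by simp
    have "(\<Union>n. G (- n)) = (\<Union>n. G n)"
    proof (rule subset_antisym)
      show "(\<Union>n. G n) \<subseteq> (\<Union>n. G (- n))"
      proof
        fix u assume "u \<in> (\<Union>n. G n)"
        then obtain n where "u \<in> G (- (- n))" by auto
        then show "u \<in> (\<Union>n. G (- n))" by blast
      qed
    qed blast
    then show "span (\<Union>n. G (- n)) = UNIV" using span_G by simp
    show "L u \<in> G (- (n + 1))" if "u \<in> G (- n)" for n u
      using L_G[OF that] by simp
    show "R u \<in> G (- (n - 1))" if "u \<in> G (- n)" for n u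
      using R_G[OF that] by simp
    show "ts (- (n + 1)) = q ^ 2 * ts (- n)" for n
      using ts_step[of "- n - 1"] by simp
    show "t (- n) = q ^ 2 * t (- (n + 1))" for n
      using t_step[of "- n - 1"] by simp
  qed
  interpret graded_q_Serre_pair scale "q ^ 2" L R Basis d G E
  proof unfold_locales
    show "q ^ 2 \<noteq> 0" using q by simp
    show "(q ^ 2) ^ n \<noteq> 1" if "n > 0" for n :: nat
      using assms(4)[of "2 * n"] that by (simp add: power_mult)
    show "fold (twist L) (map (serre_node (q ^ 2) 1) [0..<3]) R = (\<lambda>_. 0)"
      using serre_LR by (simp only: q_Serre_iff_twist[OF q q2 endo_L endo_R])
    show "fold (twist R) (map (serre_node (q ^ 2) 1) [0..<3]) L = (\<lambda>_. 0)"
      using serre_RL by (simp only: q_Serre_iff_twist[OF q q2 endo_R endo_L])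
    show "G n = {0}" if "n < 0 \<or> int d < n" for n
      using that by (auto simp: G_def)
  qed (fact endo_L[THEN endo_add] endo_L[THEN endo_scale] endo_R[THEN endo_add] endo_R[THEN endo_scale]
      endo_E[THEN endo_add] endo_E[THEN endo_scale] sub_G L_G R_G E_G)+

  show ?thesis
  proof (rule span_bounded_increasing_words)
    show "v \<in> G 0" "v \<noteq> 0" using assms(15,16) G_U[of 0] by auto
    fix W assume W: "subspace W" "W \<noteq> {0}" "L ` W \<subseteq> W" "R ` W \<subseteq> W" "\<And>n. E n ` W \<subseteq> W"
    have F_W: "F h u \<in> W" if "u \<in> W" "h \<le> d" for u h
      using W(5)[of "int h"] that by (auto simp: E_def)
    have "A u \<in> W" "As u \<in> W" if "u \<in> W" for u
    proof -
      have "A u = R u + (\<Sum>h\<le>d. scale (\<theta> h) (F h u))" "As u = L u + (\<Sum>h\<le>d. scale (\<theta>s h) (F h u))"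
        by (simp_all add: R_eq L_eq)
      then show "A u \<in> W" "As u \<in> W"
        using W F_W that by (auto intro!: subspace_add subspace_sum subspace_scale)
    qed
    with irreducible W(1,2) show "W = UNIV" by blast
  qed
qed

end
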